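(* Let $q$ be any power of a prime. Then there exist Hamiltonian cycles (in particular, at least one Hamiltonian cycle) in the middle levels graph of $\mathcal{P}_q(5)$.
   Context: For a prime power $q$ and an integer $n\ge1$, $\mathcal{P}_q(n)$ denotes the graph whose vertices are all subspaces of $\mathbb{F}_q^n$, two subspaces $X,Y$ being adjacent iff $\dim X+\dim Y-2\dim(X\cap Y)=1$ (i.e. one contains the other and their dimensions differ by one). For $n=2k+1$, the middle levels graph of $\mathcal{P}_q(2k+1)$ is the subgraph induced by the subspaces of dimension $k$ and of dimension $k+1$; here $k=2$, so its vertices are the $2$- and $3$-dimensional subspaces of $\mathbb{F}_q^5$, with a $2$-dimensional subspace adjacent to a $3$-dimensional one iff it is contained in it. A Hamiltonian cycle is a cycle passing through every vertex exactly once. *)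

theory Defs
  imports
    "HOL-Analysis.Analysis"
    "HOL-Number_Theory.Prime_Powers"
    "Graph_Theory.Graph_Theory"
begin

text \<open>
  An undirected simple graph is represented, as usual in the session Graph_Theory, by the loopfree
  symmetric digraph that has both arcs \<open>(X, Y)\<close> and \<open>(Y, X)\<close> for each edge.
\<close>

definition subspace_graph ::
    "(('a::field ^ 'n) set, ('a ^ 'n) set \<times> ('a ^ 'n) set) pre_digraph" where
  "subspace_graph =
     \<lparr> verts = {X. vec.subspace X},
       arcs = {(X, Y). vec.subspace X \<and> vec.subspace Y \<and>
                 int (vec.dim X) + int (vec.dim Y) - 2 * int (vec.dim (X \<inter> Y)) = 1},
       tail = fst, head = snd \<rparr>"

text \<open>Meant for \<open>CARD('n) = 2 * k + 1\<close>.\<close>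

definition middle_levels_graph ::
    "nat \<Rightarrow> (('a::field ^ 'n) set, ('a ^ 'n) set \<times> ('a ^ 'n) set) pre_digraph" where
  "middle_levels_graph k =
     subspace_graph \<restriction> {X. vec.subspace X \<and> (vec.dim X = k \<or> vec.dim X = k + 1)}"

text \<open>
  The library's notion of cycle requires the vertices to be distinct except that the first and the
  last one coincide, but in a symmetric digraph it admits going back and forth along a single edge;
  the length condition excludes this.
\<close>

definition hamiltonian_cycle :: "('v, 'e) pre_digraph \<Rightarrow> 'e list \<Rightarrow> bool" where
  "hamiltonian_cycle G p \<longleftrightarrow>
     pre_digraph.cycle G p \<and> 3 \<le> length p \<and>
     set (pre_digraph.awalk_verts G (tail G (hd p)) p) = verts G"

lemma symmetric_subspace_graph: "symmetric subspace_graph"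
  by (auto simp: symmetric_def sym_def arcs_ends_conv subspace_graph_def Int_commute add.commute)

lemma loopfree_subspace_graph: "loopfree_digraph subspace_graph"
  by unfold_locales (auto simp: subspace_graph_def)

end

theory Submission
  imports
    Defs
    "HOL-Algebra.Algebraic_Closure_Type"
    "HOL-Number_Theory.Cong"
begin

text \<open>
  Identify \<open>F\<^sup>5\<close> with the extension field \<open>K\<close> of degree 5. The cyclic group
  \<open>K\<^sup>*/F\<^sup>*\<close> of order \<open>N = (q\<^sup>5 - 1)/(q - 1)\<close> acts on the subspaces by
  scaling, freely on lines (dimension 2) and on planes (dimension 3). Counting the ratios of the
  elements of a plane shows that every plane is a multiple of the square
  \<open>\<langle>1, x, x\<^sup>2\<rangle>\<close> of a line \<open>\<langle>1, x\<rangle>\<close> whose orbit is unique, so squaring is a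
  bijection from the \<open>q\<^sup>2 + 1\<close> line orbits to the plane orbits. The square of
  \<open>\<langle>1, x\<rangle>\<close> contains the \<open>q + 1\<close> multiples of that line by its own points, and at least one
  member of every other line orbit. Hence the line orbits in any cyclic order, interleaved with
  their squares, form a Hamiltonian cycle of the quotient graph.

  It lifts to a single cycle iff the scaling factor accumulated along it generates
  \<open>K\<^sup>*/F\<^sup>*\<close>. This factor is a constant divided by a product of points, one chosen freely
  from each line. Every nontrivial ratio occurs in exactly one of the lines, which determines the
  mean square over the lines of a character sum; Fourier inversion and the inequality between the
  arithmetic and the geometric mean then show that for \<open>q \<ge> 3\<close> every element of
  \<open>K\<^sup>*/F\<^sup>*\<close> occurs as such a product. For \<open>q = 2\<close> the order 31 is prime and any
  nontrivial factor will do.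
\<close>

section \<open>Subspaces of a quintic extension\<close>

text \<open>Both fields of the extension become sets in one ambient type. The convention
  \<open>inverse 0 = 0\<close> lets the last condition range over all of \<open>S\<close>.\<close>

definition finite_subfield :: "'b::field set \<Rightarrow> bool" where
  "finite_subfield S \<longleftrightarrow> finite S \<and> 1 \<in> S \<and> (\<forall>x\<in>S. \<forall>y\<in>S. x - y \<in> S \<and> x * y \<in> S) \<and>
     (\<forall>x\<in>S. inverse x \<in> S)"

lemma finite_subfieldD:
  assumes "finite_subfield S"
  shows "finite S" "0 \<in> S" "1 \<in> S"
    "\<And>x y. x \<in> S \<Longrightarrow> y \<in> S \<Longrightarrow> x + y \<in> S"
    "\<And>x y. x \<in> S \<Longrightarrow> y \<in> S \<Longrightarrow> x - y \<in> S"
    "\<And>x. x \<in> S \<Longrightarrow> - x \<in> S"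
    "\<And>x y. x \<in> S \<Longrightarrow> y \<in> S \<Longrightarrow> x * y \<in> S"
    "\<And>x. x \<in> S \<Longrightarrow> inverse x \<in> S"
    "\<And>x y. x \<in> S \<Longrightarrow> y \<in> S \<Longrightarrow> x / y \<in> S"
    "\<And>x n. x \<in> S \<Longrightarrow> x ^ n \<in> S"
proof -
  note d = assms[unfolded finite_subfield_def]
  show "finite S" "1 \<in> S" using d by auto
  show 0: "0 \<in> S" using d by (metis diff_self)
  show m: "- x \<in> S" if "x \<in> S" for x using d 0 that by (metis diff_0)
  show "x + y \<in> S" if "x \<in> S" "y \<in> S" for x y using d m that by (metis diff_minus_eq_add)
  show "x - y \<in> S" "x * y \<in> S" if "x \<in> S" "y \<in> S" for x y using d that by auto
  show "inverse x \<in> S" if "x \<in> S" for x using d that by auto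
  show "x / y \<in> S" if "x \<in> S" "y \<in> S" for x y using d that by (simp add: divide_inverse)
  show "x ^ n \<in> S" if "x \<in> S" for x n using d that by (induction n) auto
qed

text \<open>Multiplication by \<open>g\<close> only permutes the factors of the product of
  \<open>W\<close>, and this nonzero product cancels.\<close>

lemma power_card_eq_1_if_scaling_invariant:
  fixes g :: "'b::field"
  assumes "finite W" "0 \<notin> W" "(*) g ` W = W"
  shows "g ^ card W = 1"
proof (cases "W = {}")
  case False
  with assms have "g \<noteq> 0" by auto
  then have "inj_on ((*) g) W" by (auto simp: inj_on_def)
  then have "\<Prod>((*) g ` W) = g ^ card W * \<Prod>W"
    by (simp add: prod.reindex prod.distrib)
  moreover have "\<Prod>W \<noteq> 0" using assms by auto
  ultimately show ?thesis using assms(3) by simp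
qed simp

text \<open>With \<open>n = card S\<close>, the elements of \<open>S\<close> are roots of
  \<open>X ^ n - X\<close>, by permuting the nonzero elements. There are at most \<open>n\<close>
  roots, so \<open>S\<close> contains all of them.\<close>

lemma mem_finite_subfield_iff:
  fixes x :: "'b::field"
  assumes S: "finite_subfield S"
  shows "x \<in> S \<longleftrightarrow> x ^ card S = x"
proof -
  note SD = finite_subfieldD[OF S]
  have le: "card {0, 1::'b} \<le> card S" by (rule card_mono) (use SD in auto)
  have pos: "card S \<ge> 2" using le by simp
  have fwd: "x ^ card S = x" if x: "x \<in> S" for x
  proof (cases "x = 0")
    case False
    have "(*) x ` (S - {0}) = S - {0}"
    proof
      show "S - {0} \<subseteq> (*) x ` (S - {0})"
      proof
        fix y assume "y \<in> S - {0}"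
        then have "y / x \<in> S - {0}" "y = x * (y / x)" using False x SD by auto
        then show "y \<in> (*) x ` (S - {0})" by blast
      qed
    qed (use SD x False in auto)
    from power_card_eq_1_if_scaling_invariant[OF _ _ this] have "x ^ card (S - {0}) = 1"
      using SD by auto
    then have "x ^ Suc (card S - 1) = x" using SD by (simp add: card_Diff_singleton)
    then show ?thesis using pos by (simp del: power_Suc)
  qed (use pos in auto)
  define p :: "'b poly" where "p = Polynomial.monom 1 (card S) - Polynomial.monom 1 1"
  have degp: "Polynomial.degree p \<le> card S"
    unfolding p_def by (intro degree_diff_le) (use pos in \<open>auto intro: order.trans[OF degree_monom_le]\<close>)
  \<comment> \<open>As \<open>card S\<close> is at least 2, the two monomials have different degrees
    and cannot cancel.\<close>
  have "poly.coeff p 1 = -1" unfolding p_def using pos by simp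
  then have "p \<noteq> 0" by auto
  have roots: "{x. poly p x = 0} = {x. x ^ card S = x}" by (simp add: p_def poly_monom)
  have "S = {x::'b. x ^ card S = x}"
  proof (rule card_seteq)
    show "finite {x::'b. x ^ card S = x}" using poly_roots_finite[OF \<open>p \<noteq> 0\<close>] unfolding roots .
    show "card {x::'b. x ^ card S = x} \<le> card S"
      using card_poly_roots_bound[OF \<open>p \<noteq> 0\<close>] degp unfolding roots by simp
  qed (use fwd in auto)
  then show ?thesis by blast
qed

section \<open>The extension and its subspaces\<close>

locale quintic_extension =
  fixes F K :: "'b::field set" and \<alpha> :: 'b and q :: nat
  assumes F: "finite_subfield F" and K: "finite_subfield K" and FK: "F \<subseteq> K"
    and card_F: "card F = q" and card_K: "card K = q ^ 5"
    and gen_K: "\<alpha> \<in> K" "\<alpha> \<noteq> 0" and gen: "\<And>x. x \<in> K \<Longrightarrow> x \<noteq> 0 \<Longrightarrow> \<exists>k. x = \<alpha> ^ k"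
begin

lemmas FD = finite_subfieldD[OF F]
lemmas KD = finite_subfieldD[OF K]
declare FD [simp, intro] KD [simp, intro]
lemma F_subset_K [simp, intro]: "x \<in> F \<Longrightarrow> x \<in> K"
  using FK by auto

lemma q_ge_2: "2 \<le> q"
proof -
  have "card {0, 1::'b} \<le> card F" by (rule card_mono) auto
  then show ?thesis using card_F by simp
qed

lemma power_less_q: "m < n \<Longrightarrow> q ^ m < q ^ n"
  using q_ge_2 by (intro power_strict_increasing) auto

text \<open>Dimensions are measured by cardinality: the \<open>k\<close>-dimensional subspaces are those with
  \<open>q ^ k\<close> elements.\<close>

definition subsp :: "'b set \<Rightarrow> bool" where
  "subsp W \<longleftrightarrow> W \<subseteq> K \<and> 0 \<in> W \<and> (\<forall>x\<in>W. \<forall>y\<in>W. x + y \<in> W) \<and> (\<forall>f\<in>F. \<forall>x\<in>W. f * x \<in> W)"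

lemma subspD:
  assumes "subsp W"
  shows "W \<subseteq> K" "0 \<in> W" "finite W" "\<And>x y. x \<in> W \<Longrightarrow> y \<in> W \<Longrightarrow> x + y \<in> W"
    "\<And>x y. x \<in> W \<Longrightarrow> y \<in> W \<Longrightarrow> x - y \<in> W" "\<And>f x. f \<in> F \<Longrightarrow> x \<in> W \<Longrightarrow> f * x \<in> W"
proof -
  note d = assms[unfolded subsp_def]
  show "W \<subseteq> K" "0 \<in> W" "\<And>x y. x \<in> W \<Longrightarrow> y \<in> W \<Longrightarrow> x + y \<in> W"
    "\<And>f x. f \<in> F \<Longrightarrow> x \<in> W \<Longrightarrow> f * x \<in> W" using d by auto
  show "finite W" using d KD(1) finite_subset by auto
  show "x - y \<in> W" if "x \<in> W" "y \<in> W" for x y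
  proof -
    have "-1 \<in> F" by auto
    then have "-1 * y \<in> W" using d that by blast
    then have "x + -1 * y \<in> W" using d that by blast
    then show ?thesis by simp
  qed
qed

lemma subsp_scale:
  assumes "subsp W" "a \<in> K"
  shows "subsp ((*) a ` W)"
proof -
  note W = subspD[OF assms(1)]
  show ?thesis unfolding subsp_def
  proof (intro conjI ballI)
    show "(*) a ` W \<subseteq> K" using W assms by auto
    show "0 \<in> (*) a ` W" using W by (auto intro!: image_eqI[of _ _ 0])
    show "x + y \<in> (*) a ` W" if "x \<in> (*) a ` W" "y \<in> (*) a ` W" for x y
    proof -
      from that obtain u v where "u \<in> W" "x = a * u" "v \<in> W" "y = a * v" by auto
      then show ?thesis using W by (auto intro!: image_eqI[of _ _ "u + v"] simp: algebra_simps)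
    qed
    show "f * x \<in> (*) a ` W" if "f \<in> F" "x \<in> (*) a ` W" for f x
    proof -
      from that obtain u where "u \<in> W" "x = a * u" by auto
      then show ?thesis using W that by (auto intro!: image_eqI[of _ _ "f * u"] simp: algebra_simps)
    qed
  qed
qed

lemma card_scale: "a \<noteq> 0 \<Longrightarrow> card ((*) a ` W) = card W" for a :: 'b
  by (intro card_image) (auto simp: inj_on_def)

lemma scale_eq_iff: "a \<noteq> 0 \<Longrightarrow> (*) a ` W = Y \<longleftrightarrow> W = (*) (1 / a) ` Y" for a :: 'b
  by (auto simp: image_image)

text \<open>The cardinality form of \<open>dim A + dim B > dim C\<close>: by pigeonhole two pairs
  have the same sum, and the difference of their first components lies in both subspaces.\<close>

lemma subsp_Int_nontrivial:
  assumes A: "subsp A" "A \<subseteq> C" and B: "subsp B" "B \<subseteq> C" and C: "subsp C"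
    and less: "card C < card A * card B"
  shows "\<exists>z. z \<in> A \<and> z \<in> B \<and> z \<noteq> 0"
proof -
  note A' = subspD[OF A(1)] and B' = subspD[OF B(1)] and C' = subspD[OF C]
  have "(\<lambda>(x, y). x + y) ` (A \<times> B) \<subseteq> C" using C'(4)[OF subsetD[OF A(2)] subsetD[OF B(2)]] by auto
  then have "card ((\<lambda>(x, y). x + y) ` (A \<times> B)) \<le> card C" by (rule card_mono[OF C'(3)])
  also have "\<dots> < card (A \<times> B)" using less by (simp add: card_cartesian_product)
  finally have "\<not> inj_on (\<lambda>(x, y). x + y) (A \<times> B)"
    using card_image[of "\<lambda>(x, y). x + y" "A \<times> B"] by auto
  then obtain x y x' y' where *: "x \<in> A" "y \<in> B" "x' \<in> A" "y' \<in> B" "x + y = x' + y'"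
    "(x, y) \<noteq> (x', y')" by (auto simp: inj_on_def)
  then have "x - x' = y' - y" by (simp add: algebra_simps)
  then have "x - x' \<in> B" using B'(5)[of y' y] * by simp
  moreover have "x - x' \<in> A" using A'(5) * by simp
  moreover have "x - x' \<noteq> 0" using * by auto
  ultimately show ?thesis by blast
qed

text \<open>Multiplication by \<open>g\<close> permutes the nonzero elements of \<open>W\<close>, so comparing their
  products shows that \<open>g\<close> is fixed by the Frobenius power \<open>q ^ k\<close>; it is also fixed by
  \<open>q ^ 5\<close>, and \<open>k\<close> is coprime to 5.\<close>

lemma scaling_stabilizer:
  assumes W: "subsp W" "card W = q ^ 2 \<or> card W = q ^ 3" and g: "g \<in> K" and inv: "(*) g ` W = W"
  shows "g \<in> F"
proof -
  note W' = subspD[OF W(1)]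
  have *: "W \<noteq> {0}" using W(2) power_less_q[of 0 2] power_less_q[of 0 3] by auto
  then have g0: "g \<noteq> 0" using inv W' by auto
  have "(*) g ` (W - {0}) = W - {0}"
  proof -
    have "(*) g ` (W - {0}) = (*) g ` W - (*) g ` {0}"
      by (rule image_set_diff) (use g0 in \<open>auto simp: inj_on_def\<close>)
    then show ?thesis using inv by simp
  qed
  from power_card_eq_1_if_scaling_invariant[OF _ _ this]
  have "g ^ (card W - 1) = 1" using W' by (simp add: card_Diff_singleton)
  then have "g ^ Suc (card W - 1) = g" by simp
  moreover have "card W > 0" using W' by (auto simp: card_gt_0_iff)
  ultimately have 1: "g ^ card W = g" by (simp del: power_Suc)
  have 5: "g ^ (q ^ 5) = g" using g mem_finite_subfield_iff[OF K] card_K by simp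
  have "g ^ q = g" using W(2)
  proof
    assume c: "card W = q ^ 2"
    \<comment> \<open>Here 5 = 2 + 2 + 1: two powers with exponent \<open>q ^ 2\<close> fix
      \<open>g\<close>, which leaves the \<open>q\<close>-th power.\<close>
    have "g ^ (q ^ 5) = ((g ^ (q ^ 2)) ^ (q ^ 2)) ^ q"
      by (simp add: power_mult[symmetric] power_add[symmetric] numeral_eq_Suc mult.assoc)
    then show ?thesis using 1 5 c by simp
  next
    assume c: "card W = q ^ 3"
    \<comment> \<open>Here 5 + 1 = 3 + 3.\<close>
    have "(g ^ (q ^ 5)) ^ q = (g ^ (q ^ 3)) ^ (q ^ 3)"
      by (simp add: power_mult[symmetric] power_add[symmetric] numeral_eq_Suc mult.assoc)
    then show ?thesis using 1 5 c by simp
  qed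
  then show ?thesis using mem_finite_subfield_iff[OF F] card_F by simp
qed

section \<open>Lines and planes in normal form\<close>

definition line_of :: "'b \<Rightarrow> 'b set" where
  "line_of x = (\<lambda>(f, g). f + g * x) ` (F \<times> F)"

text \<open>The square of \<open>line_of x\<close>, that is, the span of the products of two of its
  elements.\<close>

definition plane_of :: "'b \<Rightarrow> 'b set" where
  "plane_of x = (\<lambda>(f, g, h). f + g * x + h * x ^ 2) ` (F \<times> F \<times> F)"

lemma line_ofI: "f \<in> F \<Longrightarrow> g \<in> F \<Longrightarrow> f + g * x \<in> line_of x"
  by (force simp: line_of_def)

lemma line_ofE: "y \<in> line_of x \<Longrightarrow> (\<And>f g. f \<in> F \<Longrightarrow> g \<in> F \<Longrightarrow> y = f + g * x \<Longrightarrow> P) \<Longrightarrow> P"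
  by (auto simp: line_of_def)

lemma plane_ofI: "f \<in> F \<Longrightarrow> g \<in> F \<Longrightarrow> h \<in> F \<Longrightarrow> f + g * x + h * x ^ 2 \<in> plane_of x"
  by (force simp: plane_of_def)

lemma plane_ofE: "y \<in> plane_of x \<Longrightarrow>
    (\<And>f g h. f \<in> F \<Longrightarrow> g \<in> F \<Longrightarrow> h \<in> F \<Longrightarrow> y = f + g * x + h * x ^ 2 \<Longrightarrow> P) \<Longrightarrow> P"
  by (auto simp: plane_of_def)

lemma one_line_of: "1 \<in> line_of x" and self_line_of: "x \<in> line_of x"
  using line_ofI[of 1 0 x] line_ofI[of 0 1 x] by auto

lemma subsp_line_of: assumes "x \<in> K" shows "subsp (line_of x)"
  unfolding subsp_def
proof (intro conjI ballI)
  show "line_of x \<subseteq> K" using assms FK by (auto simp: line_of_def)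
  show "0 \<in> line_of x" using line_ofI[of 0 0 x] by simp
  show "u + v \<in> line_of x" if "u \<in> line_of x" "v \<in> line_of x" for u v
  proof -
    from that obtain f g f' g' where "f \<in> F" "g \<in> F" "f' \<in> F" "g' \<in> F" "u = f + g * x"
      "v = f' + g' * x" by (auto elim!: line_ofE)
    then show ?thesis using line_ofI[of "f + f'" "g + g'" x] by (simp add: algebra_simps)
  qed
  show "c * u \<in> line_of x" if "c \<in> F" "u \<in> line_of x" for c u
  proof -
    from that obtain f g where "f \<in> F" "g \<in> F" "u = f + g * x" by (auto elim!: line_ofE)
    then show ?thesis using line_ofI[of "c * f" "c * g" x] that by (simp add: algebra_simps)
  qed
qed

lemma subsp_plane_of: assumes "x \<in> K" shows "subsp (plane_of x)"
  unfolding subsp_def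
proof (intro conjI ballI)
  show "plane_of x \<subseteq> K" using assms FK by (auto simp: plane_of_def)
  show "0 \<in> plane_of x" using plane_ofI[of 0 0 0 x] by simp
  show "u + v \<in> plane_of x" if "u \<in> plane_of x" "v \<in> plane_of x" for u v
  proof -
    from that obtain f g h f' g' h' where "f \<in> F" "g \<in> F" "h \<in> F" "f' \<in> F" "g' \<in> F" "h' \<in> F"
      "u = f + g * x + h * x ^ 2" "v = f' + g' * x + h' * x ^ 2" by (auto elim!: plane_ofE)
    then show ?thesis using plane_ofI[of "f + f'" "g + g'" "h + h'" x] by (simp add: algebra_simps)
  qed
  show "c * u \<in> plane_of x" if "c \<in> F" "u \<in> plane_of x" for c u
  proof -
    from that obtain f g h where "f \<in> F" "g \<in> F" "h \<in> F" "u = f + g * x + h * x ^ 2"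
      by (auto elim!: plane_ofE)
    then show ?thesis using plane_ofI[of "c * f" "c * g" "c * h" x] that by (simp add: algebra_simps)
  qed
qed

text \<open>Every nonzero point of a line thus scales the whole line into its square; the free
  choice of this point is what later adjusts the scaling factor.\<close>

lemma line_of_mult_line_of:
  assumes "c \<in> line_of x" "d \<in> line_of x" shows "c * d \<in> plane_of x"
proof -
  from assms obtain f g f' g' where "f \<in> F" "g \<in> F" "f' \<in> F" "g' \<in> F" "c = f + g * x"
    "d = f' + g' * x" by (auto elim!: line_ofE)
  then show ?thesis using plane_ofI[of "f * f'" "f * g' + g * f'" "g * g'" x]
    by (simp add: algebra_simps power2_eq_square)
qed

lemma card_line_of: assumes "x \<in> K - F" shows "card (line_of x) = q ^ 2"
proof -
  have "inj_on (\<lambda>(f, g). f + g * x) (F \<times> F)"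
  proof (rule inj_onI, clarify)
    fix f g f' g' assume *: "f \<in> F" "g \<in> F" "f' \<in> F" "g' \<in> F" "f + g * x = f' + g' * x"
    have "g = g'"
    proof (rule ccontr)
      assume "g \<noteq> g'"
      have "(g - g') * x = f' - f" using *(5) by (simp add: algebra_simps)
      then have "x = (f' - f) / (g - g')" using \<open>g \<noteq> g'\<close> by (simp add: eq_divide_eq mult.commute)
      then show False using assms *(1-4) by simp
    qed
    then show "f = f' \<and> g = g'" using * by auto
  qed
  then show ?thesis by (simp add: line_of_def card_image card_F power2_eq_square)
qed

text \<open>If 1, \<open>x\<close>, \<open>x ^ 2\<close> were dependent, the line of
  \<open>x\<close> would be invariant under multiplication by \<open>x\<close>, and
  \<open>scaling_stabilizer\<close> would put \<open>x\<close> into \<open>F\<close>.\<close>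

lemma card_plane_of: assumes x: "x \<in> K - F" shows "card (plane_of x) = q ^ 3"
proof -
  have x2: "x ^ 2 \<notin> line_of x"
  proof
    assume "x ^ 2 \<in> line_of x"
    then obtain u v where uv: "u \<in> F" "v \<in> F" "x ^ 2 = u + v * x" by (auto elim: line_ofE)
    have x0: "x \<noteq> 0" using x by auto
    have "(*) x ` line_of x \<subseteq> line_of x"
    proof
      fix y assume "y \<in> (*) x ` line_of x"
      then obtain f g where fg: "f \<in> F" "g \<in> F" "y = x * (f + g * x)" by (auto elim!: line_ofE)
      then have "y = f * x + g * x ^ 2" by (simp add: algebra_simps power2_eq_square)
      also have "\<dots> = g * u + (f + g * v) * x" by (simp add: uv algebra_simps)
      finally show "y \<in> line_of x" using line_ofI[of "g * u" "f + g * v" x] fg uv by simp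
    qed
    then have "(*) x ` line_of x = line_of x"
      using card_scale[OF x0] subspD(3)[OF subsp_line_of] x by (intro card_subset_eq) auto
    moreover have "subsp (line_of x)" "card (line_of x) = q ^ 2" using subsp_line_of card_line_of x by auto
    ultimately have "x \<in> F" using scaling_stabilizer[of "line_of x" x] x by blast
    then show False using x by blast
  qed
  have "inj_on (\<lambda>(f, g, h). f + g * x + h * x ^ 2) (F \<times> F \<times> F)"
  proof (rule inj_onI)
    fix s t assume "s \<in> F \<times> F \<times> F" "t \<in> F \<times> F \<times> F"
      "(\<lambda>(f, g, h). f + g * x + h * x ^ 2) s = (\<lambda>(f, g, h). f + g * x + h * x ^ 2) t"
    then obtain f g h f' g' h' where
      *: "f \<in> F" "g \<in> F" "h \<in> F" "f' \<in> F" "g' \<in> F" "h' \<in> F"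
        "f + g * x + h * x ^ 2 = f' + g' * x + h' * x ^ 2"
      and st: "s = (f, g, h)" "t = (f', g', h')"
      by auto
    have h: "h = h'"
    proof (rule ccontr)
      assume "h \<noteq> h'"
      have "(h - h') * x ^ 2 = (f' - f) + (g' - g) * x" using *(7) by (simp add: algebra_simps)
      then have "x ^ 2 = ((f' - f) + (g' - g) * x) / (h - h')" using \<open>h \<noteq> h'\<close>
        by (simp add: eq_divide_eq mult.commute)
      then have "x ^ 2 = (f' - f) / (h - h') + (g' - g) / (h - h') * x"
        by (simp add: add_divide_distrib)
      then show False using x2 line_ofI[of "(f' - f) / (h - h')" "(g' - g) / (h - h')" x] *(1-6) by simp
    qed
    have "g = g'"
    proof (rule ccontr)
      assume "g \<noteq> g'"
      have "(g - g') * x = f' - f" using *(7) h by (simp add: algebra_simps)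
      then have "x = (f' - f) / (g - g')" using \<open>g \<noteq> g'\<close> by (simp add: eq_divide_eq mult.commute)
      then show False using assms *(1-6) by simp
    qed
    then show "s = t" using *(7) h st by simp
  qed
  then show ?thesis by (simp add: plane_of_def card_image card_F numeral_eq_Suc)
qed

lemma line_eq:
  assumes W: "subsp W" "card W = q ^ 2" and ab: "a \<in> W" "b \<in> W" "a \<noteq> 0" "b / a \<notin> F"
  shows "W = (*) a ` line_of (b / a)"
proof (rule sym, rule card_subset_eq)
  note W' = subspD[OF W(1)]
  show "finite W" using W' by auto
  have "b / a \<in> K - F" using ab W' by auto
  then show "card ((*) a ` line_of (b / a)) = card W" using card_scale card_line_of W ab by simp
  show "(*) a ` line_of (b / a) \<subseteq> W"
  proof
    fix y assume "y \<in> (*) a ` line_of (b / a)"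
    then obtain f g where fg: "f \<in> F" "g \<in> F" "y = a * (f + g * (b / a))" by (auto elim!: line_ofE)
    then have "y = f * a + g * b" using ab by (simp add: distrib_left mult.commute)
    then show "y \<in> W" using W' ab fg by auto
  qed
qed

lemma plane_eq:
  assumes W: "subsp W" "card W = q ^ 3" and r: "r \<in> K - F"
    and a: "a \<noteq> 0" "a \<in> W" "a * r \<in> W" "a * r ^ 2 \<in> W"
  shows "W = (*) a ` plane_of r"
proof (rule sym, rule card_subset_eq)
  note W' = subspD[OF W(1)]
  show "finite W" using W' by auto
  show "card ((*) a ` plane_of r) = card W" using card_scale card_plane_of W a r by simp
  show "(*) a ` plane_of r \<subseteq> W"
  proof
    fix y assume "y \<in> (*) a ` plane_of r"
    then obtain f g h where fg: "f \<in> F" "g \<in> F" "h \<in> F" "y = a * (f + g * r + h * r ^ 2)"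
      by (auto elim!: plane_ofE)
    then have "y = f * a + g * (a * r) + h * (a * r ^ 2)" by (simp add: algebra_simps)
    then show "y \<in> W" using W' a fg by auto
  qed
qed

lemma independent_pair:
  assumes W: "subsp W" "card W > q"
  obtains a b where "a \<in> W" "b \<in> W" "a \<noteq> 0" "b / a \<notin> F"
proof -
  note W' = subspD[OF W(1)]
  have "W \<noteq> {0}" using W q_ge_2 by auto
  then obtain a where a: "a \<in> W" "a \<noteq> 0" using W' by auto
  have "\<not> W \<subseteq> (*) a ` F"
  proof
    assume "W \<subseteq> (*) a ` F"
    then have "card W \<le> card ((*) a ` F)" by (intro card_mono) auto
    then show False using card_scale[OF a(2)] card_F W by simp
  qed
  then obtain b where b: "b \<in> W" "b \<notin> (*) a ` F" by auto
  have "b / a \<notin> F"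
  proof
    assume "b / a \<in> F"
    then have "a * (b / a) \<in> (*) a ` F" by blast
    then show False using b a by simp
  qed
  then show ?thesis using that a b by blast
qed

lemma line_form:
  assumes "subsp W" "card W = q ^ 2"
  obtains a r where "a \<in> K" "a \<noteq> 0" "r \<in> K - F" "W = (*) a ` line_of r"
proof -
  have "card W > q" using assms power_less_q[of 1 2] by simp
  from independent_pair[OF assms(1) this] obtain a b where ab: "a \<in> W" "b \<in> W" "a \<noteq> 0" "b / a \<notin> F" .
  then have "a \<in> K" "b / a \<in> K - F" using subspD(1)[OF assms(1)] by auto
  then show ?thesis using that line_eq[OF assms ab] ab by blast
qed


section \<open>Counting ratios\<close>

text \<open>Its nonzero elements are the possible denominators when \<open>r\<close> is written as a
  ratio of two elements of \<open>W\<close>; \<open>ratio_count\<close> is the number of these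
  representations.\<close>

definition ratio_space :: "'b set \<Rightarrow> 'b \<Rightarrow> 'b set" where
  "ratio_space W r = {c \<in> W. r * c \<in> W}"

definition ratio_count :: "'b set \<Rightarrow> 'b \<Rightarrow> nat" where
  "ratio_count W r = card (ratio_space W r - {0})"

lemma subsp_ratio_space:
  assumes "subsp W"
  shows "subsp (ratio_space W r)"
proof -
  note W' = subspD[OF assms]
  show ?thesis unfolding subsp_def ratio_space_def
    using W' by (auto simp: distrib_left mult.left_commute)
qed

lemma ratio_count_eq: "subsp W \<Longrightarrow> ratio_count W r = card (ratio_space W r) - 1"
  using subspD[OF subsp_ratio_space] by (simp add: ratio_count_def card_Diff_singleton)

text \<open>Numerators and denominators scale alike, so the count is an invariant of the orbit of
  \<open>W\<close>.\<close>

lemma ratio_count_scale: "a \<noteq> 0 \<Longrightarrow> ratio_count ((*) a ` W) r = ratio_count W r"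
proof -
  assume a: "a \<noteq> 0"
  have "ratio_space ((*) a ` W) r - {0} = (*) a ` (ratio_space W r - {0})"
  proof (intro equalityI subsetI)
    fix y assume "y \<in> ratio_space ((*) a ` W) r - {0}"
    then obtain c d where "y = a * c" "c \<in> W" "r * (a * c) = a * d" "d \<in> W" "y \<noteq> 0"
      by (auto simp: ratio_space_def)
    moreover from this have "r * c = d" using a by (simp add: mult.left_commute)
    ultimately show "y \<in> (*) a ` (ratio_space W r - {0})" by (auto simp: ratio_space_def)
  next
    fix y assume "y \<in> (*) a ` (ratio_space W r - {0})"
    then show "y \<in> ratio_space ((*) a ` W) r - {0}"
      using a by (auto simp: ratio_space_def mult.left_commute)
  qed
  then show ?thesis using card_scale[OF a] by (simp add: ratio_count_def)
qed

text \<open>Double counting of the pairs of a nonzero \<open>c\<close> in \<open>W\<close> and a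
  \<open>d\<close> in \<open>W\<close> that is no \<open>F\<close>-multiple of \<open>c\<close>,
  with \<open>r = d / c\<close>.\<close>

lemma sum_ratio_count:
  assumes W: "subsp W"
  shows "(\<Sum>r\<in>K - F. ratio_count W r) = (card W - 1) * (card W - q)"
proof -
  note W' = subspD[OF W]
  have inner: "card {r \<in> K - F. r * c \<in> W} = card W - q" if c: "c \<in> W - {0}" for c
  proof -
    have "{r \<in> K - F. r * c \<in> W} = (\<lambda>d. d / c) ` (W - (*) c ` F)"
    proof (intro equalityI subsetI)
      fix r assume r: "r \<in> {r \<in> K - F. r * c \<in> W}"
      then have "r * c \<notin> (*) c ` F" using c by auto
      then show "r \<in> (\<lambda>d. d / c) ` (W - (*) c ` F)" using r c
        by (intro image_eqI[of _ _ "r * c"]) auto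
    next
      fix r assume "r \<in> (\<lambda>d. d / c) ` (W - (*) c ` F)"
      then obtain d where d: "d \<in> W" "d \<notin> (*) c ` F" "r = d / c" by auto
      moreover have "d / c \<notin> F"
      proof
        assume "d / c \<in> F"
        then have "c * (d / c) \<in> (*) c ` F" by blast
        then show False using d c by simp
      qed
      ultimately show "r \<in> {r \<in> K - F. r * c \<in> W}" using c W' by auto
    qed
    moreover have "inj_on (\<lambda>d. d / c) (W - (*) c ` F)" using c by (auto simp: inj_on_def)
    ultimately have "card {r \<in> K - F. r * c \<in> W} = card (W - (*) c ` F)" by (simp add: card_image)
    also have "\<dots> = card W - card ((*) c ` F)"
      by (rule card_Diff_subset) (use W' c in \<open>auto simp: mult.commute\<close>)
    finally show ?thesis using card_scale[of c F] c card_F by simp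
  qed
  have "(\<Sum>r\<in>K - F. ratio_count W r) = (\<Sum>r\<in>K - F. \<Sum>c\<in>W - {0}. if r * c \<in> W then 1 else 0)"
    unfolding ratio_count_def ratio_space_def using W'
    by (intro sum.cong refl) (simp add: sum.If_cases card_eq_sum[symmetric] Int_def conj_commute
        set_diff_eq conj_left_commute conj_assoc)
  also have "\<dots> = (\<Sum>c\<in>W - {0}. \<Sum>r\<in>K - F. if r * c \<in> W then 1 else 0)" by (rule sum.swap)
  also have "\<dots> = (\<Sum>c\<in>W - {0}. card W - q)"
    by (intro sum.cong refl) (use inner in \<open>simp add: sum.If_cases Int_def\<close>)
  also have "\<dots> = (card W - 1) * (card W - q)" using W' by (simp add: card_Diff_singleton)
  finally show ?thesis .
qed

lemma card_subsp_ge: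
  assumes W: "subsp W" and z: "z \<in> W" "z \<noteq> 0"
  shows "q \<le> card W"
proof -
  have "(*) z ` F \<subseteq> W" using subspD[OF W] z by (auto simp: mult.commute)
  then have "card ((*) z ` F) \<le> card W" using subspD[OF W] by (intro card_mono) auto
  then show ?thesis using card_scale z card_F by simp
qed

text \<open>Since 3 + 3 > 5, the plane meets its multiple by \<open>1 / r\<close>. A nonzero common
  element brings its \<open>q - 1\<close> nonzero \<open>F\<close>-multiples along as
  denominators.\<close>

lemma ratio_count_plane_ge:
  assumes W: "subsp W" "card W = q ^ 3" and r: "r \<in> K - F"
  shows "q - 1 \<le> ratio_count W r"
proof -
  note W' = subspD[OF W(1)]
  have r0: "r \<noteq> 0" using r by auto
  have K_subsp: "subsp K" by (auto simp: subsp_def)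
  have "\<exists>z. z \<in> W \<and> z \<in> (*) (1 / r) ` W \<and> z \<noteq> 0"
  proof (rule subsp_Int_nontrivial[where C = K])
    show "subsp W" "W \<subseteq> K" "subsp K" using W W' K_subsp by auto
    show s: "subsp ((*) (1 / r) ` W)" by (rule subsp_scale) (use W r in auto)
    show "(*) (1 / r) ` W \<subseteq> K" using subspD(1)[OF s] .
    show "card K < card W * card ((*) (1 / r) ` W)"
      using W r0 card_scale[of "1 / r" W] power_less_q[of 5 6] card_K
      by (simp add: power_add[symmetric])
  qed
  then obtain z w where z: "z \<in> W" "z = (1 / r) * w" "w \<in> W" "z \<noteq> 0" by auto
  then have "z \<in> ratio_space W r" using r0 by (auto simp: ratio_space_def)
  then have "q \<le> card (ratio_space W r)" using card_subsp_ge[OF subsp_ratio_space] W z by blast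
  then show ?thesis using ratio_count_eq W by simp
qed

lemma card_K_minus_F: "card (K - F) = q ^ 5 - q"
  by (simp add: card_Diff_subset FK card_F card_K)

text \<open>The total ratio count of a plane exceeds the trivial bound by
  \<open>q^2 (q - 1)^2 (q + 1)\<close>. The integers keep the subtractions exact.\<close>

lemma plane_sum_gt: "(q - 1) * (q ^ 5 - q) < (q ^ 3 - 1) * (q ^ 3 - q)"
proof -
  have "int ((q ^ 3 - 1) * (q ^ 3 - q)) - int ((q - 1) * (q ^ 5 - q))
      = (int q ^ 3 - 1) * (int q ^ 3 - int q) - (int q - 1) * (int q ^ 5 - int q)"
    using power_less_q[of 1 5] power_less_q[of 1 3] power_less_q[of 0 3] q_ge_2
    by (simp add: of_nat_diff)
  also have "\<dots> = int q ^ 2 * (int q - 1) ^ 2 * (int q + 1)"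
    by (simp add: eval_nat_numeral algebra_simps)
  also have "\<dots> > 0" using q_ge_2 by auto
  finally show ?thesis by linarith
qed

text \<open>By the ratio count some \<open>r\<close> occurs as a ratio more often than the trivial bound requires;
  then \<open>M = W \<inter> r\<inverse> W\<close> has dimension at least 2, so that \<open>M\<close> and \<open>r M\<close> share a
  nonzero element \<open>r m\<close> of \<open>W\<close>, and \<open>m, r m, r\<^sup>2 m\<close> all lie in \<open>W\<close>.\<close>

lemma plane_form:
  assumes W: "subsp W" "card W = q ^ 3"
  obtains a r where "a \<in> K" "a \<noteq> 0" "r \<in> K - F" "W = (*) a ` plane_of r"
proof -
  note W' = subspD[OF W(1)]
  have "\<exists>r\<in>K - F. ratio_count W r \<ge> q"
  proof (rule ccontr)
    assume "\<not> ?thesis"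
    then have "ratio_count W r \<le> q - 1" if "r \<in> K - F" for r
      using that by (metis Suc_pred' less_Suc_eq_le not_le q_ge_2 order.strict_trans2 zero_less_numeral)
    then have "(\<Sum>r\<in>K - F. ratio_count W r) \<le> (\<Sum>r\<in>K - F. q - 1)" by (intro sum_mono)
    then show False using sum_ratio_count[OF W(1)] W(2) plane_sum_gt card_K_minus_F
      by (simp add: mult.commute)
  qed
  then obtain r where r: "r \<in> K - F" "ratio_count W r \<ge> q" by auto
  then have r0: "r \<noteq> 0" by auto
  define M where "M = ratio_space W r"
  have M: "subsp M" "M \<subseteq> W" "(*) r ` M \<subseteq> W" unfolding M_def using W subsp_ratio_space
    by (auto simp: ratio_space_def)
  have "card M > q" using ratio_count_eq[OF W(1)] r q_ge_2 by (simp add: M_def)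
  then obtain a b where ab: "a \<in> M" "b \<in> M" "a \<noteq> 0" "b / a \<notin> F"
    using independent_pair[OF M(1)] by metis
  have aK: "a \<in> K" "b \<in> K" using ab M W' by auto
  \<comment> \<open>The count gives only \<open>card M > q\<close>; the line spanned by an
    independent pair raises this to \<open>q ^ 2\<close>.\<close>
  have "(*) a ` line_of (b / a) \<subseteq> M"
  proof
    fix y assume "y \<in> (*) a ` line_of (b / a)"
    then obtain f g where fg: "f \<in> F" "g \<in> F" "y = a * (f + g * (b / a))" by (auto elim!: line_ofE)
    then have "y = f * a + g * b" using ab by (simp add: distrib_left mult.commute)
    then show "y \<in> M" using subspD[OF M(1)] ab fg by auto
  qed
  then have "card ((*) a ` line_of (b / a)) \<le> card M" using subspD[OF M(1)] by (intro card_mono)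
  then have cM: "q ^ 2 \<le> card M" using card_scale ab card_line_of[of "b / a"] aK by simp
  have "\<exists>z. z \<in> M \<and> z \<in> (*) r ` M \<and> z \<noteq> 0"
  proof (rule subsp_Int_nontrivial[where C = W])
    show "subsp ((*) r ` M)" by (rule subsp_scale) (use M r in auto)
    have "card W < q ^ 2 * q ^ 2" using W power_less_q[of 3 4] by (simp add: power_add[symmetric])
    also have "\<dots> \<le> card M * card M" using cM by (intro mult_mono) auto
    finally show "card W < card M * card ((*) r ` M)" using card_scale r0 by simp
  qed (use M W in auto)
  then obtain m where m: "m \<in> M" "r * m \<in> M" "m \<noteq> 0" by auto
  then have mW: "m \<in> W" "m * r \<in> W" "m * r ^ 2 \<in> W"
    unfolding M_def ratio_space_def by (auto simp: power2_eq_square mult_ac)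
  then have "m \<in> K" using W' by auto
  from that[OF this m(3) r(1) plane_eq[OF W r(1) m(3) mW]] show ?thesis .
qed

section \<open>Line orbits as classes of ratios\<close>

text \<open>Orbits of lines under scaling correspond to these classes, the orbit of the line of \<open>r\<close>
  to the class containing \<open>r\<close>.\<close>

definition ratio_class :: "'b \<Rightarrow> 'b set" where
  "ratio_class x = {r \<in> K - F. \<exists>c\<in>line_of x. c \<noteq> 0 \<and> r * c \<in> line_of x}"

lemma line_of_eq_scale:
  assumes "x \<in> K - F" "r \<in> K - F" "c \<in> line_of x" "c \<noteq> 0" "r * c \<in> line_of x"
  shows "line_of x = (*) c ` line_of r"
  using line_eq[of "line_of x" c "r * c"] assms subsp_line_of card_line_of by auto

text \<open>If \<open>c\<close> and \<open>r * c\<close> lie in the line of \<open>x\<close>, they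
  are \<open>c\<close> times the basis 1, \<open>r\<close>. Conversely, \<open>a\<close> carries 1
  and \<open>r\<close> to two points of ratio \<open>r\<close>.\<close>

lemma ratio_class_iff:
  assumes x: "x \<in> K - F" and r: "r \<in> K - F"
  shows "r \<in> ratio_class x \<longleftrightarrow> (\<exists>a\<in>K. a \<noteq> 0 \<and> line_of x = (*) a ` line_of r)"
proof
  assume "r \<in> ratio_class x"
  then obtain c where c: "c \<in> line_of x" "c \<noteq> 0" "r * c \<in> line_of x" by (auto simp: ratio_class_def)
  then have "c \<in> K" using subspD(1)[OF subsp_line_of] x by auto
  then show "\<exists>a\<in>K. a \<noteq> 0 \<and> line_of x = (*) a ` line_of r" using line_of_eq_scale[OF x r c] c by auto
next
  assume "\<exists>a\<in>K. a \<noteq> 0 \<and> line_of x = (*) a ` line_of r"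
  then obtain a where a: "a \<in> K" "a \<noteq> 0" "line_of x = (*) a ` line_of r" by auto
  then have "a * 1 \<in> line_of x" "a * r \<in> line_of x" using one_line_of self_line_of by blast+
  then show "r \<in> ratio_class x"
    using a(2) r by (auto simp: ratio_class_def mult.commute intro!: bexI[of _ "a * 1"])
qed

lemma ratio_class_subset: "ratio_class x \<subseteq> K - F"
  by (auto simp: ratio_class_def)

lemma self_ratio_class: "x \<in> K - F \<Longrightarrow> x \<in> ratio_class x"
  unfolding ratio_class_def using one_line_of[of x] self_line_of[of x]
  by (auto intro!: bexI[of _ 1])

text \<open>Scaling preserves ratios. Together with \<open>self_ratio_class\<close> this makes the
  classes a partition of \<open>K - F\<close>.\<close>

lemma ratio_class_eq:
  assumes x: "x \<in> K - F" and r: "r \<in> ratio_class x"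
  shows "ratio_class r = ratio_class x"
proof -
  have rK: "r \<in> K - F" using r ratio_class_subset by auto
  then obtain a where a: "a \<in> K" "a \<noteq> 0" "line_of x = (*) a ` line_of r"
    using ratio_class_iff[OF x] r by auto
  have "(\<exists>c\<in>line_of r. c \<noteq> 0 \<and> s * c \<in> line_of r) \<longleftrightarrow>
      (\<exists>c\<in>line_of x. c \<noteq> 0 \<and> s * c \<in> line_of x)" for s
  proof -
    have "s * c \<in> line_of r \<longleftrightarrow> s * (a * c) \<in> line_of x" for c
      using a(2) unfolding a(3) by (auto simp: mult.left_commute)
    then show ?thesis using a(2) unfolding a(3) by auto
  qed
  then show ?thesis by (simp add: ratio_class_def)
qed

text \<open>Within an orbit it suffices to look at the line of \<open>r\<close> itself. A
  denominator \<open>c\<close> of \<open>r\<close> there maps this line onto itself, hence lies in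
  \<open>F\<close>.\<close>

lemma ratio_count_line:
  assumes x: "x \<in> K - F" and r: "r \<in> K - F"
  shows "ratio_count (line_of x) r = (if r \<in> ratio_class x then q - 1 else 0)"
proof (cases "r \<in> ratio_class x")
  case False
  then have "ratio_space (line_of x) r - {0} = {}"
    using r by (auto simp: ratio_class_def ratio_space_def)
  then show ?thesis using False by (simp only: ratio_count_def card.empty if_False)
next
  case True
  then obtain a where a: "a \<in> K" "a \<noteq> 0" "line_of x = (*) a ` line_of r"
    using ratio_class_iff[OF x r] by auto
  have "ratio_space (line_of r) r - {0} = F - {0}"
  proof (intro equalityI subsetI)
    fix c assume "c \<in> ratio_space (line_of r) r - {0}"
    then have c: "c \<in> line_of r" "c \<noteq> 0" "r * c \<in> line_of r" by (auto simp: ratio_space_def)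
    then have "c \<in> K" using subspD(1)[OF subsp_line_of] r by auto
    moreover have "(*) c ` line_of r = line_of r" using line_of_eq_scale[OF r r c] by simp
    ultimately have "c \<in> F" using scaling_stabilizer[of "line_of r" c] subsp_line_of card_line_of r
      by blast
    then show "c \<in> F - {0}" using c by simp
  next
    fix c assume "c \<in> F - {0}"
    then show "c \<in> ratio_space (line_of r) r - {0}"
      using line_ofI[of c 0 r] line_ofI[of 0 c r] by (auto simp: ratio_space_def mult.commute)
  qed
  then have "ratio_count (line_of r) r = q - 1"
    by (simp add: ratio_count_def card_Diff_singleton card_F)
  then show ?thesis using ratio_count_scale[OF a(2)] a(3) True by simp
qed

text \<open>Each ratio of the line is represented \<open>q - 1\<close> times, so the total ratio
  count is divided by \<open>q - 1\<close>.\<close>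

lemma card_ratio_class:
  assumes x: "x \<in> K - F"
  shows "card (ratio_class x) = q * (q ^ 2 - 1)"
proof -
  have "(\<Sum>r\<in>K - F. ratio_count (line_of x) r) = (\<Sum>r\<in>K - F. if r \<in> ratio_class x then q - 1 else 0)"
    by (intro sum.cong refl) (use ratio_count_line[OF x] in auto)
  also have "\<dots> = card (ratio_class x) * (q - 1)"
    using ratio_class_subset[of x] by (simp add: sum.If_cases Int_absorb1)
  finally have "card (ratio_class x) * (q - 1) = (q ^ 2 - 1) * (q ^ 2 - q)"
    using sum_ratio_count[OF subsp_line_of] card_line_of[OF x] x by simp
  also have "q ^ 2 - q = q * (q - 1)" by (simp add: power2_eq_square right_diff_distrib')
  finally show ?thesis using q_ge_2 by (simp add: mult.commute)
qed

text \<open>If \<open>r = d / c\<close> with \<open>c\<close>, \<open>d\<close> on the line, then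
  every nonzero \<open>u\<close> on the line yields the denominator \<open>c * u\<close> and the
  numerator \<open>d * u\<close> in the plane.\<close>

lemma ratio_count_plane_of:
  assumes x: "x \<in> K - F" and r: "r \<in> ratio_class x"
  shows "q ^ 2 - 1 \<le> ratio_count (plane_of x) r"
proof -
  from r obtain c where c: "c \<in> line_of x" "c \<noteq> 0" "r * c \<in> line_of x" by (auto simp: ratio_class_def)
  have "(*) c ` (line_of x - {0}) \<subseteq> ratio_space (plane_of x) r - {0}"
    using line_of_mult_line_of[OF c(1)] line_of_mult_line_of[OF c(3)] c(2)
    by (auto simp: ratio_space_def mult.assoc)
  then have "card ((*) c ` (line_of x - {0})) \<le> ratio_count (plane_of x) r"
    unfolding ratio_count_def using subspD(3)[OF subsp_ratio_space[OF subsp_plane_of]] x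
    by (intro card_mono) auto
  then show ?thesis using card_scale[OF c(2)] card_line_of[OF x] subspD[OF subsp_line_of] x
    by (simp add: card_Diff_singleton)
qed

text \<open>The ratios of the line of \<open>x\<close> alone account for the whole excess of the ratio count of
  the plane over the trivial bound, leaving no room for a second class.\<close>

lemma plane_of_scale_imp_ratio_class:
  assumes x: "x \<in> K - F" and y: "y \<in> K - F" and a: "a \<noteq> 0" and eq: "plane_of y = (*) a ` plane_of x"
  shows "y \<in> ratio_class x"
proof (rule ccontr)
  assume ny: "y \<notin> ratio_class x"
  have disj: "ratio_class x \<inter> ratio_class y = {}"
  proof (rule ccontr)
    assume "ratio_class x \<inter> ratio_class y \<noteq> {}"
    then obtain r where "r \<in> ratio_class x" "r \<in> ratio_class y" by auto
    then have "ratio_class x = ratio_class y" using ratio_class_eq x y by metis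
    then show False using ny self_ratio_class[OF y] by simp
  qed
  define U where "U = ratio_class x \<union> ratio_class y"
  have U: "U \<subseteq> K - F" using ratio_class_subset by (auto simp: U_def)
  have finU: "finite U" using U by (rule finite_subset) simp
  have cardU: "card U = 2 * (q * (q ^ 2 - 1))" unfolding U_def
    using card_ratio_class[OF x] card_ratio_class[OF y] disj finU
    by (subst card_Un_disjoint) (auto simp: U_def)
  have ge: "q ^ 2 - 1 \<le> ratio_count (plane_of x) r" if "r \<in> U" for r
    using that ratio_count_plane_of[OF x] ratio_count_plane_of[OF y] ratio_count_scale[OF a] eq
    by (auto simp: U_def)
  have W: "subsp (plane_of x)" "card (plane_of x) = q ^ 3" using subsp_plane_of card_plane_of x by auto
  have "card U * (q ^ 2 - 1) + card (K - F - U) * (q - 1)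
      \<le> (\<Sum>r\<in>U. ratio_count (plane_of x) r) + (\<Sum>r\<in>K - F - U. ratio_count (plane_of x) r)"
    using sum_bounded_below[of U "q ^ 2 - 1" "ratio_count (plane_of x)"] ge
      sum_bounded_below[of "K - F - U" "q - 1" "ratio_count (plane_of x)"] ratio_count_plane_ge[OF W]
    by (intro add_mono) auto
  also have "\<dots> = (\<Sum>r\<in>K - F. ratio_count (plane_of x) r)"
    using U by (subst (2) sum.subset_diff[of U]) auto
  also have "\<dots> = (q ^ 3 - 1) * (q ^ 3 - q)" using sum_ratio_count[OF W(1)] W(2) by simp
  finally have le: "card U * (q ^ 2 - 1) + card (K - F - U) * (q - 1) \<le> (q ^ 3 - 1) * (q ^ 3 - q)" .
  have "card U \<le> card (K - F)" using U by (intro card_mono) auto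
  moreover have "card (K - F - U) = card (K - F) - card U" using U finU by (simp add: card_Diff_subset)
  ultimately have "int (card (K - F - U)) = (int q ^ 5 - int q) - int (card U)"
    using power_less_q[of 1 5] by (simp add: card_K_minus_F of_nat_diff)
  moreover have iU: "int (card U) = 2 * (int q * (int q ^ 2 - 1))"
    using power_less_q[of 0 2] by (simp add: cardU of_nat_diff)
  moreover have "int ((q ^ 3 - 1) * (q ^ 3 - q)) = (int q ^ 3 - 1) * (int q ^ 3 - int q)"
    using power_less_q[of 0 3] power_less_q[of 1 3] by (simp add: of_nat_diff)
  moreover have "int (card U * (q ^ 2 - 1) + card (K - F - U) * (q - 1))
      = int (card U) * (int q ^ 2 - 1) + int (card (K - F - U)) * (int q - 1)"
    using power_less_q[of 0 2] q_ge_2 by (simp add: of_nat_diff)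
  ultimately have "2 * (int q * (int q ^ 2 - 1)) * (int q ^ 2 - 1) +
      (int q ^ 5 - int q - 2 * (int q * (int q ^ 2 - 1))) * (int q - 1)
      \<le> (int q ^ 3 - 1) * (int q ^ 3 - int q)"
    using le by (metis of_nat_le_iff)
  \<comment> \<open>One class exceeds the trivial bound by
    \<open>q (q^2 - 1) (q^2 - q) = q^2 (q - 1)^2 (q + 1)\<close>, which is already the entire
    excess; two classes overshoot by the same amount.\<close>
  moreover have "2 * (int q * (int q ^ 2 - 1)) * (int q ^ 2 - 1) +
      (int q ^ 5 - int q - 2 * (int q * (int q ^ 2 - 1))) * (int q - 1)
      - (int q ^ 3 - 1) * (int q ^ 3 - int q) = int q ^ 2 * (int q - 1) ^ 2 * (int q + 1)"
    by (simp add: eval_nat_numeral algebra_simps)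
  moreover have "int q ^ 2 * (int q - 1) ^ 2 * (int q + 1) > 0" using q_ge_2 by auto
  ultimately show False by linarith
qed

text \<open>The classes partition \<open>K - F\<close> into sets of equal size, and
  \<open>q^5 - q = q (q^2 - 1) (q^2 + 1)\<close>.\<close>

lemma card_ratio_classes: "card (ratio_class ` (K - F)) = q ^ 2 + 1"
proof -
  have un: "\<Union>(ratio_class ` (K - F)) = K - F" using ratio_class_subset self_ratio_class by blast
  have "q * (q ^ 2 - 1) * card (ratio_class ` (K - F)) = card (\<Union>(ratio_class ` (K - F)))"
  proof (rule card_partition)
    show "finite (ratio_class ` (K - F))" "finite (\<Union>(ratio_class ` (K - F)))" using un by auto
    show "card c = q * (q ^ 2 - 1)" if "c \<in> ratio_class ` (K - F)" for c
      using that card_ratio_class by auto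
    show "c1 \<inter> c2 = {}" if "c1 \<in> ratio_class ` (K - F)" "c2 \<in> ratio_class ` (K - F)" "c1 \<noteq> c2" for c1 c2
      using that ratio_class_eq by blast
  qed
  also have "\<dots> = q ^ 5 - q" using un card_K_minus_F by simp
  also have "\<dots> = q * (q ^ 2 - 1) * (q ^ 2 + 1)"
  proof -
    have "int (q ^ 5 - q) = int q ^ 5 - int q" using power_less_q[of 1 5] by (simp add: of_nat_diff)
    also have "\<dots> = int q * (int q ^ 2 - 1) * (int q ^ 2 + 1)"
      by (simp add: eval_nat_numeral algebra_simps)
    also have "\<dots> = int (q * (q ^ 2 - 1) * (q ^ 2 + 1))"
      using power_less_q[of 0 2] by (simp add: of_nat_diff distrib_left)
    finally show ?thesis by (simp only: of_nat_eq_iff)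
  qed
  finally have "q * (q ^ 2 - 1) * card (ratio_class ` (K - F)) = q * (q ^ 2 - 1) * (q ^ 2 + 1)" .
  moreover have "q * (q ^ 2 - 1) \<noteq> 0" using q_ge_2 power_less_q[of 0 2] by simp
  ultimately show ?thesis by (metis mult_left_cancel)
qed

end

section \<open>The scaling factors of the lifted cycles\<close>

text \<open>The inequality of the arithmetic and geometric means, from
  \<open>t \<le> exp (t - 1)\<close> at \<open>t = a i / A\<close>: the exponents add up to
  0.\<close>

lemma prod_le_mean_power:
  fixes a :: "'i \<Rightarrow> real" and A :: real
  assumes I: "finite I" and pos: "\<And>i. i \<in> I \<Longrightarrow> 0 \<le> a i" and A: "0 < A"
    and sum: "(\<Sum>i\<in>I. a i) = card I * A"
  shows "(\<Prod>i\<in>I. a i) \<le> A ^ card I"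
proof -
  have "(\<Prod>i\<in>I. a i / A) \<le> (\<Prod>i\<in>I. exp (a i / A - 1))"
  proof (rule prod_mono)
    fix i assume "i \<in> I"
    then show "0 \<le> a i / A \<and> a i / A \<le> exp (a i / A - 1)"
      using exp_ge_add_one_self[of "a i / A - 1"] pos A by auto
  qed
  also have "\<dots> = exp (\<Sum>i\<in>I. (a i / A - 1))" using I by (simp add: exp_sum)
  also have "(\<Sum>i\<in>I. (a i / A - 1)) = 0"
    using A by (simp add: sum_subtractf sum_divide_distrib[symmetric] sum)
  finally show ?thesis using A by (simp add: prod_dividef)
qed

context quintic_extension begin

section \<open>The quotient of the multiplicative groups and its characters\<close>

definition N :: nat where "N = q ^ 4 + q ^ 3 + q ^ 2 + q + 1"

lemma N_mult: "N * (q - 1) = q ^ 5 - 1"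
proof -
  obtain t where t: "q = Suc t" using q_ge_2 by (cases q) auto
  have "N * q = N + (q ^ 5 - 1)"
    using power_less_q[of 0 5] by (simp add: N_def eval_nat_numeral algebra_simps)
  then show ?thesis by (simp add: t)
qed

lemma N_pos: "N > 0" by (simp add: N_def)

lemma power_gen_in [simp]: "\<alpha> ^ k \<in> K" "\<alpha> ^ k \<noteq> 0"
  using gen_K by auto

text \<open>The powers of \<alpha> with exponent below \<open>q ^ 5 - 1\<close> exhaust the
  \<open>q ^ 5 - 1\<close> nonzero elements of \<open>K\<close>, so they are distinct.\<close>

lemma gen_power_eq_1_iff: "\<alpha> ^ k = 1 \<longleftrightarrow> (q ^ 5 - 1) dvd k"
proof -
  define M where "M = q ^ 5 - 1"
  have M: "M > 0" using power_less_q[of 0 5] by (simp add: M_def)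
  have "\<alpha> ^ Suc M = \<alpha>"
  proof -
    have "Suc M = q ^ 5" using M by (simp add: M_def)
    then show ?thesis using gen_K(1) mem_finite_subfield_iff[OF K, of \<alpha>] card_K by (simp only:)
  qed
  then have aM: "\<alpha> ^ M = 1" using gen_K by simp
  have red: "\<alpha> ^ k = \<alpha> ^ (k mod M)" for k
  proof -
    have "\<alpha> ^ k = \<alpha> ^ (M * (k div M) + k mod M)" by simp
    also have "\<dots> = \<alpha> ^ (k mod M)" unfolding power_add power_mult aM by simp
    finally show ?thesis .
  qed
  have "K - {0} \<subseteq> (\<lambda>k. \<alpha> ^ k) ` {..<M}"
  proof
    fix x assume "x \<in> K - {0}"
    then obtain k where "x = \<alpha> ^ k" using gen by auto
    then show "x \<in> (\<lambda>k. \<alpha> ^ k) ` {..<M}" using red[of k] M by (intro image_eqI[of _ _ "k mod M"]) auto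
  qed
  then have "(\<lambda>k. \<alpha> ^ k) ` {..<M} = K - {0}" using gen_K by auto
  moreover have "card (K - {0}) = M" by (simp add: card_Diff_singleton card_K M_def)
  ultimately have inj: "inj_on (\<lambda>k. \<alpha> ^ k) {..<M}" by (intro eq_card_imp_inj_on) auto
  have "\<alpha> ^ k = 1 \<longleftrightarrow> \<alpha> ^ (k mod M) = \<alpha> ^ 0" using red[of k] by simp
  also have "\<dots> \<longleftrightarrow> k mod M = 0" using inj_on_eq_iff[OF inj, of "k mod M" 0] M by auto
  finally show ?thesis by (auto simp: M_def)
qed

lemma nonzero_F_iff:
  assumes "x \<noteq> 0" shows "x \<in> F \<longleftrightarrow> x ^ (q - 1) = 1"
proof -
  have "x \<in> F \<longleftrightarrow> x ^ Suc (q - 1) = x"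
    using mem_finite_subfield_iff[OF F] card_F q_ge_2 by (simp del: power_Suc)
  also have "\<dots> \<longleftrightarrow> x ^ (q - 1) = 1" using assms by simp
  finally show ?thesis .
qed

text \<open>The power \<open>q - 1\<close> detects \<open>F\<close>, and the factor
  \<open>q - 1\<close> cancels from the order \<open>N * (q - 1)\<close> of \<alpha>.\<close>

lemma gen_power_in_F_iff: "\<alpha> ^ k \<in> F \<longleftrightarrow> N dvd k"
proof -
  have "\<alpha> ^ k \<in> F \<longleftrightarrow> \<alpha> ^ (k * (q - 1)) = 1" using nonzero_F_iff[OF power_gen_in(2)] by (simp only: power_mult)
  also have "\<dots> \<longleftrightarrow> N * (q - 1) dvd k * (q - 1)" by (simp only: gen_power_eq_1_iff N_mult)
  also have "\<dots> \<longleftrightarrow> N dvd k" using q_ge_2 by simp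
  finally show ?thesis .
qed

text \<open>\<open>\<psi>\<close> is a faithful character of \<open>K\<^sup>*/F\<^sup>*\<close>; all characters are its powers. Its
  value at 0 is junk.\<close>

definition \<omega> :: complex where "\<omega> = cis (2 * pi / N)"

definition dlog :: "'b \<Rightarrow> nat" where "dlog x = (SOME k. x = \<alpha> ^ k)"

definition \<psi> :: "'b \<Rightarrow> complex" where "\<psi> x = \<omega> ^ dlog x"

lemma omega_power_eq_1_iff: "\<omega> ^ k = 1 \<longleftrightarrow> N dvd k"
proof
  assume "N dvd k"
  then obtain l where "k = N * l" by auto
  moreover have "\<omega> ^ N = 1" using N_pos by (simp add: \<omega>_def Complex.DeMoivre)
  ultimately show "\<omega> ^ k = 1" by (simp add: power_mult)
next
  assume "\<omega> ^ k = 1"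
  then have "cis (real k * (2 * pi / N)) = 1" by (simp add: \<omega>_def Complex.DeMoivre)
  then have "cos (real k * (2 * pi / N)) = 1" by (metis cis.simps(1) one_complex.simps(1))
  then obtain n :: int where "real k * (2 * pi / N) = n * 2 * pi" by (auto simp: cos_one_2pi_int)
  then have "real k = n * N" using N_pos by (simp add: field_simps)
  then have "int k = n * int N" by (metis of_int_eq_iff of_int_mult of_int_of_nat_eq)
  then show "N dvd k" by (metis dvd_triv_right of_nat_dvd_iff)
qed

text \<open>Makes \<psi> independent of the exponent that \<open>dlog\<close> chooses.\<close>

lemma omega_power_cong:
  assumes "\<alpha> ^ k = \<alpha> ^ l" shows "\<omega> ^ k = \<omega> ^ l"
proof -
  have *: "\<omega> ^ k = \<omega> ^ l" if "\<alpha> ^ k = \<alpha> ^ l" "l \<le> k" for k l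
  proof -
    have "\<alpha> ^ (k - l) = 1" using that by (simp add: power_diff gen_K)
    then have "\<alpha> ^ (k - l) \<in> F" by simp
    then have "\<omega> ^ (k - l) = 1" using gen_power_in_F_iff omega_power_eq_1_iff by simp
    then have "\<omega> ^ (k - l) * \<omega> ^ l = \<omega> ^ l" by simp
    then show ?thesis using that by (simp add: power_add[symmetric])
  qed
  show ?thesis using *[of k l] *[of l k] assms by (cases "l \<le> k") auto
qed

lemma psi_gen_power: "\<psi> (\<alpha> ^ k) = \<omega> ^ k"
proof -
  have "\<alpha> ^ k = \<alpha> ^ dlog (\<alpha> ^ k)" unfolding dlog_def by (rule someI[of _ k]) simp
  then show ?thesis using omega_power_cong unfolding \<psi>_def by metis
qed

lemma psi_mult:
  assumes "x \<in> K - {0}" "y \<in> K - {0}" shows "\<psi> (x * y) = \<psi> x * \<psi> y"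
proof -
  obtain k l where "x = \<alpha> ^ k" "y = \<alpha> ^ l" using assms gen by (metis Diff_iff singletonI)
  then show ?thesis by (simp add: psi_gen_power power_add[symmetric])
qed

lemma psi_1: "\<psi> 1 = 1"
  using psi_gen_power[of 0] by simp

lemma norm_psi: "norm (\<psi> x) = 1"
  by (simp add: \<psi>_def \<omega>_def norm_power)

lemma psi_eq_1_iff: assumes "x \<in> K - {0}" shows "\<psi> x = 1 \<longleftrightarrow> x \<in> F"
proof -
  obtain k where "x = \<alpha> ^ k" using assms gen by auto
  then show ?thesis by (simp add: psi_gen_power omega_power_eq_1_iff gen_power_in_F_iff)
qed

lemma psi_prod:
  assumes "finite I" "\<And>i. i \<in> I \<Longrightarrow> c i \<in> K - {0}"
  shows "\<psi> (\<Prod>i\<in>I. c i) = (\<Prod>i\<in>I. \<psi> (c i)) \<and> (\<Prod>i\<in>I. c i) \<in> K - {0}"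
  using assms
proof (induction I)
  case (insert i I)
  then have "\<psi> (c i * prod c I) = \<psi> (c i) * \<psi> (prod c I)" by (intro psi_mult) auto
  then show ?case using insert by simp
qed (simp add: psi_1)

text \<open>Orthogonality over the characters: outside \<open>F\<close> this is a full geometric sum
  of an \<open>N\<close>-th root of unity other than 1.\<close>

lemma sum_psi_powers:
  assumes "x \<in> K - {0}" shows "(\<Sum>j<N. \<psi> x ^ j) = (if x \<in> F then of_nat N else 0)"
proof (cases "x \<in> F")
  case False
  obtain k where k: "x = \<alpha> ^ k" using assms gen by auto
  then have "\<psi> x ^ N = 1" by (simp add: psi_gen_power power_mult[symmetric] omega_power_eq_1_iff)
  moreover have "\<psi> x \<noteq> 1" using psi_eq_1_iff[OF assms] False by simp
  ultimately show ?thesis using False by (simp add: geometric_sum)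
qed (use psi_eq_1_iff[OF assms] in simp)

text \<open>Orthogonality over the group: replacing \<open>x\<close> by \<open>\<alpha> * x\<close>
  multiplies the sum by \<open>\<omega> ^ j\<close>, which differs from 1.\<close>

lemma sum_psi_power_K:
  assumes "0 < j" "j < N" shows "(\<Sum>x\<in>K - {0}. \<psi> x ^ j) = 0"
proof -
  have "(\<Sum>x\<in>K - {0}. \<psi> x ^ j) = (\<Sum>x\<in>K - {0}. \<psi> (\<alpha> * x) ^ j)"
    by (rule sum.reindex_bij_witness[of _ "\<lambda>x. \<alpha> * x" "\<lambda>x. x / \<alpha>"]) (use gen_K in auto)
  also have "\<dots> = (\<Sum>x\<in>K - {0}. \<omega> ^ j * \<psi> x ^ j)"
  proof (rule sum.cong)
    fix x assume "x \<in> K - {0}"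
    then have "\<psi> (\<alpha> * x) = \<psi> (\<alpha> ^ 1) * \<psi> x" using psi_mult gen_K by simp
    then show "\<psi> (\<alpha> * x) ^ j = \<omega> ^ j * \<psi> x ^ j" unfolding psi_gen_power by (simp add: power_mult_distrib)
  qed simp
  finally have "(1 - \<omega> ^ j) * (\<Sum>x\<in>K - {0}. \<psi> x ^ j) = 0"
    by (simp add: sum_distrib_left[symmetric] algebra_simps)
  moreover have "\<omega> ^ j \<noteq> 1" using assms by (auto simp: omega_power_eq_1_iff dest: dvd_imp_le)
  ultimately show ?thesis by simp
qed

section \<open>Character sums over lines\<close>

definition line_sum :: "nat \<Rightarrow> 'b \<Rightarrow> complex" where
  "line_sum j x = (\<Sum>c\<in>line_of x - {0}. \<psi> c ^ j)"

text \<open>The squared norm is a sum over pairs of points, in which each term depends only on the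
  ratio; the ratio counts give the multiplicities.\<close>

lemma norm_line_sum:
  assumes x: "x \<in> K - F"
  shows "of_real ((norm (line_sum j x)) ^ 2) =
    of_nat ((q - 1) * (q ^ 2 - 1)) + of_nat (q - 1) * (\<Sum>r\<in>ratio_class x. \<psi> r ^ j)"
proof -
  define L where "L = line_of x"
  have L: "subsp L" "card L = q ^ 2" using x subsp_line_of card_line_of by (auto simp: L_def)
  note L' = subspD[OF L(1)]
  have LK: "c \<in> K" if "c \<in> L" for c using L'(1) that by auto
  have "of_real ((norm (line_sum j x)) ^ 2) = line_sum j x * cnj (line_sum j x)"
    by (rule complex_norm_square)
  also have "\<dots> = (\<Sum>d\<in>L - {0}. \<Sum>c\<in>L - {0}. \<psi> c ^ j * cnj (\<psi> d ^ j))"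
    unfolding line_sum_def L_def[symmetric] cnj_sum sum_product by (rule sum.swap)
  \<comment> \<open>Substitute \<open>c = r * d\<close>; conjugation inverts the value at
    \<open>d\<close>.\<close>
  also have "\<dots> = (\<Sum>d\<in>L - {0}. \<Sum>r\<in>K - {0}. if r * d \<in> L then \<psi> r ^ j else 0)"
  proof (rule sum.cong[OF refl])
    fix d assume d: "d \<in> L - {0}"
    then have dK: "d \<in> K - {0}" using LK by auto
    have "(\<Sum>c\<in>L - {0}. \<psi> c ^ j * cnj (\<psi> d ^ j)) = (\<Sum>r\<in>{r \<in> K - {0}. r * d \<in> L}. \<psi> r ^ j)"
    proof (rule sum.reindex_bij_witness[of _ "\<lambda>r. r * d" "\<lambda>c. c / d"])
      fix c assume c: "c \<in> L - {0}"
      then have cK: "c / d \<in> K - {0}" using LK dK by auto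
      have "\<psi> c = \<psi> (c / d) * \<psi> d" using psi_mult[OF cK dK] dK by simp
      then have "\<psi> c ^ j * cnj (\<psi> d ^ j) = \<psi> (c / d) ^ j * (\<psi> d * cnj (\<psi> d)) ^ j"
        by (simp add: power_mult_distrib)
      also have "\<psi> d * cnj (\<psi> d) = 1" using complex_norm_square[of "\<psi> d"] norm_psi[of d] by simp
      finally show "\<psi> (c / d) ^ j = \<psi> c ^ j * cnj (\<psi> d ^ j)" by simp
      show "c / d \<in> {r \<in> K - {0}. r * d \<in> L}" using cK c d by simp
    qed (use d in auto)
    also have "\<dots> = (\<Sum>r\<in>K - {0}. if r * d \<in> L then \<psi> r ^ j else 0)"
      by (simp add: sum.If_cases Int_def)
    finally show "(\<Sum>c\<in>L - {0}. \<psi> c ^ j * cnj (\<psi> d ^ j)) =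
      (\<Sum>r\<in>K - {0}. if r * d \<in> L then \<psi> r ^ j else 0)" .
  qed
  also have "\<dots> = (\<Sum>r\<in>K - {0}. \<Sum>d\<in>L - {0}. if r * d \<in> L then \<psi> r ^ j else 0)" by (rule sum.swap)
  also have "\<dots> = (\<Sum>r\<in>K - {0}. of_nat (ratio_count L r) * \<psi> r ^ j)"
  proof (rule sum.cong[OF refl])
    fix r
    have "ratio_space L r - {0} = {d \<in> L - {0}. r * d \<in> L}" by (auto simp: ratio_space_def)
    then show "(\<Sum>d\<in>L - {0}. if r * d \<in> L then \<psi> r ^ j else 0) = of_nat (ratio_count L r) * \<psi> r ^ j"
      using L' by (simp add: sum.If_cases ratio_count_def Int_def)
  qed
  \<comment> \<open>Ratios in \<open>F\<close> have character value 1 and every nonzero vector as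
    denominator; for the others only the class of \<open>x\<close> counts.\<close>
  also have "K - {0} = (F - {0}) \<union> (K - F)" by auto
  also have "(\<Sum>r\<in>(F - {0}) \<union> (K - F). of_nat (ratio_count L r) * \<psi> r ^ j) =
     (\<Sum>r\<in>F - {0}. of_nat (ratio_count L r) * \<psi> r ^ j) + (\<Sum>r\<in>K - F. of_nat (ratio_count L r) * \<psi> r ^ j)"
    by (rule sum.union_disjoint) auto
  also have "(\<Sum>r\<in>F - {0}. of_nat (ratio_count L r) * \<psi> r ^ j) = (\<Sum>r\<in>F - {0}. of_nat (q ^ 2 - 1))"
  proof (rule sum.cong[OF refl])
    fix r assume r: "r \<in> F - {0}"
    then have "ratio_space L r = L" using L' by (auto simp: ratio_space_def)
    then have "ratio_count L r = q ^ 2 - 1" using ratio_count_eq[OF L(1)] L(2) by simp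
    moreover have "\<psi> r = 1" using psi_eq_1_iff r by auto
    ultimately show "of_nat (ratio_count L r) * \<psi> r ^ j = of_nat (q ^ 2 - 1)" by simp
  qed
  also have "(\<Sum>r\<in>K - F. of_nat (ratio_count L r) * \<psi> r ^ j)
      = (\<Sum>r\<in>K - F. if r \<in> ratio_class x then of_nat (q - 1) * \<psi> r ^ j else 0)"
    by (rule sum.cong[OF refl]) (simp add: L_def ratio_count_line[OF x])
  also have "\<dots> = of_nat (q - 1) * (\<Sum>r\<in>ratio_class x. \<psi> r ^ j)"
    using ratio_class_subset[of x] by (simp add: sum.If_cases Int_absorb1 sum_distrib_left)
  finally show ?thesis by (simp add: card_Diff_singleton card_F)
qed

text \<open>One line from each orbit; the indices give the cyclic order of the quotient
  cycle.\<close>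

definition transversal :: "(nat \<Rightarrow> 'b) \<Rightarrow> bool" where
  "transversal x \<longleftrightarrow> (\<forall>i<q ^ 2 + 1. x i \<in> K - F) \<and>
     bij_betw (\<lambda>i. ratio_class (x i)) {..<q ^ 2 + 1} (ratio_class ` (K - F))"

lemma transversal_exists: "\<exists>x. transversal x"
proof -
  have "finite (ratio_class ` (K - F))" by simp
  from ex_bij_betw_nat_finite[OF this] obtain h where
    h: "bij_betw h {..<q ^ 2 + 1} (ratio_class ` (K - F))"
    unfolding card_ratio_classes by (auto simp: lessThan_atLeast0)
  have "\<exists>y. y \<in> K - F \<and> ratio_class y = h i" if "i < q ^ 2 + 1" for i
    using bij_betwE[OF h] that by blast
  then obtain x where x: "\<And>i. i < q ^ 2 + 1 \<Longrightarrow> x i \<in> K - F \<and> ratio_class (x i) = h i" by metis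
  then have "bij_betw (\<lambda>i. ratio_class (x i)) {..<q ^ 2 + 1} (ratio_class ` (K - F))"
    using h by (subst bij_betw_cong[of _ _ h]) auto
  then show ?thesis using x by (auto simp: transversal_def)
qed

text \<open>The classes partition \<open>K - F\<close>, so the ratio sums add up to the vanishing
  sum over all nonzero elements minus the \<open>q - 1\<close> contributed by \<open>F\<close>.
  Hence the total is the same for every nontrivial \<open>j\<close>.\<close>

lemma sum_norm_line_sum:
  assumes x: "transversal x" and j: "0 < j" "j < N"
  shows "(\<Sum>i<q ^ 2 + 1. (norm (line_sum j (x i))) ^ 2)
    = (real q - 1) ^ 2 * ((real q ^ 2 + 1) * (real q + 1) - 1)"
proof -
  define m where "m = q ^ 2 + 1"
  have xK: "x i \<in> K - F" if "i < m" for i using x that by (simp add: transversal_def m_def)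
  have bij: "bij_betw (\<lambda>i. ratio_class (x i)) {..<m} (ratio_class ` (K - F))"
    using x by (simp add: transversal_def m_def)
  have un: "(\<Union>i<m. ratio_class (x i)) = K - F"
  proof -
    have "(\<Union>i<m. ratio_class (x i)) = \<Union>(ratio_class ` (K - F))"
      using bij by (metis bij_betw_imp_surj_on)
    also have "\<dots> = K - F" using ratio_class_subset self_ratio_class by blast
    finally show ?thesis .
  qed
  have "(\<Sum>i<m. \<Sum>r\<in>ratio_class (x i). \<psi> r ^ j) = (\<Sum>r\<in>(\<Union>i<m. ratio_class (x i)). \<psi> r ^ j)"
  proof (rule sum.UNION_disjoint[symmetric])
    show "\<forall>i\<in>{..<m}. finite (ratio_class (x i))"
      using ratio_class_subset finite_subset[of _ "K - F"] by auto
    show "\<forall>i\<in>{..<m}. \<forall>k\<in>{..<m}. i \<noteq> k \<longrightarrow> ratio_class (x i) \<inter> ratio_class (x k) = {}"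
    proof (intro ballI impI)
      fix i k assume ik: "i \<in> {..<m}" "k \<in> {..<m}" "i \<noteq> k"
      then have "ratio_class (x i) \<noteq> ratio_class (x k)"
        using bij by (auto simp: bij_betw_def inj_on_def)
      then show "ratio_class (x i) \<inter> ratio_class (x k) = {}"
        using ratio_class_eq[OF xK] ik by blast
    qed
  qed simp
  also have "\<dots> = (\<Sum>r\<in>K - F. \<psi> r ^ j)" unfolding un ..
  also have "\<dots> = (\<Sum>r\<in>(K - {0}) - (F - {0}). \<psi> r ^ j)" by (rule sum.cong) auto
  also have "\<dots> = (\<Sum>r\<in>K - {0}. \<psi> r ^ j) - (\<Sum>r\<in>F - {0}. \<psi> r ^ j)"
    by (rule sum_diff) auto
  also have "(\<Sum>r\<in>F - {0}. \<psi> r ^ j) = (\<Sum>r\<in>F - {0}. 1)"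
  proof (rule sum.cong[OF refl])
    fix r assume "r \<in> F - {0}"
    then have "\<psi> r = 1" using psi_eq_1_iff by auto
    then show "\<psi> r ^ j = 1" by simp
  qed
  finally have total: "(\<Sum>i<m. \<Sum>r\<in>ratio_class (x i). \<psi> r ^ j) = - of_nat (q - 1)"
    using sum_psi_power_K[OF j] by (simp add: card_Diff_singleton card_F)
  have "complex_of_real (\<Sum>i<m. (norm (line_sum j (x i))) ^ 2)
      = (\<Sum>i<m. of_nat ((q - 1) * (q ^ 2 - 1)) + of_nat (q - 1) * (\<Sum>r\<in>ratio_class (x i). \<psi> r ^ j))"
    unfolding of_real_sum by (rule sum.cong[OF refl], rule norm_line_sum) (use xK in auto)
  also have "\<dots> = of_nat (m * ((q - 1) * (q ^ 2 - 1))) - of_nat ((q - 1) * (q - 1))"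
    unfolding sum.distrib sum_distrib_left[symmetric] total by simp
  also have "\<dots> = complex_of_real (real (m * ((q - 1) * (q ^ 2 - 1))) - real ((q - 1) * (q - 1)))"
    by simp
  finally have "(\<Sum>i<m. (norm (line_sum j (x i))) ^ 2)
      = real (m * ((q - 1) * (q ^ 2 - 1))) - real ((q - 1) * (q - 1))"
    by (simp only: of_real_eq_iff)
  also have "\<dots> = (real q ^ 2 + 1) * ((real q - 1) * (real q ^ 2 - 1)) - (real q - 1) * (real q - 1)"
    using q_ge_2 power_less_q[of 0 2] by (simp add: m_def of_nat_diff distrib_right)
  also have "\<dots> = (real q - 1) ^ 2 * ((real q ^ 2 + 1) * (real q + 1) - 1)"
    by (simp add: eval_nat_numeral algebra_simps)
  finally show ?thesis unfolding m_def .
qed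

text \<open>Fourier inversion counts the choices. If there were none, the main term of the trivial
  character would have to be cancelled by the others, which are too small.\<close>

lemma prod_points_meets_F:
  assumes x: "transversal x" and q3: "3 \<le> q" and \<beta>: "\<beta> \<in> K - {0}"
  shows "\<exists>c. (\<forall>i<q ^ 2 + 1. c i \<in> line_of (x i) - {0}) \<and> \<beta> * (\<Prod>i<q ^ 2 + 1. c i) \<in> F"
proof (rule ccontr)
  assume contra: "\<not> ?thesis"
  define m where "m = q ^ 2 + 1"
  have xK: "x i \<in> K - F" if "i < m" for i using x that by (simp add: transversal_def m_def)
  define P where "P = (\<Pi>\<^sub>E i\<in>{..<m}. line_of (x i) - {0})"
  have cK: "c i \<in> K - {0}" if "c \<in> P" "i < m" for c i
    using that subspD(1)[OF subsp_line_of] xK[of i] by (force simp: P_def PiE_def Pi_def)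
  have prodK: "(\<Prod>i<m. c i) \<in> K - {0}" "\<psi> (\<Prod>i<m. c i) = (\<Prod>i<m. \<psi> (c i))" if "c \<in> P" for c
    using psi_prod[of "{..<m}" c] cK[OF that] by auto
  have "(\<Sum>c\<in>P. \<Sum>j<N. \<psi> (\<beta> * (\<Prod>i<m. c i)) ^ j) = 0"
  proof (rule sum.neutral, rule ballI)
    fix c assume c: "c \<in> P"
    have "\<beta> * (\<Prod>i<m. c i) \<notin> F" using contra c by (auto simp: P_def m_def PiE_def Pi_def)
    moreover have "\<beta> * (\<Prod>i<m. c i) \<in> K - {0}" using \<beta> prodK(1)[OF c] by auto
    ultimately show "(\<Sum>j<N. \<psi> (\<beta> * (\<Prod>i<m. c i)) ^ j) = 0" using sum_psi_powers by simp
  qed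
  also have "(\<Sum>c\<in>P. \<Sum>j<N. \<psi> (\<beta> * (\<Prod>i<m. c i)) ^ j)
      = (\<Sum>j<N. \<Sum>c\<in>P. \<psi> \<beta> ^ j * (\<Prod>i<m. \<psi> (c i) ^ j))"
    by (subst sum.swap, intro sum.cong refl)
      (use psi_mult[OF \<beta>] prodK in \<open>simp add: power_mult_distrib prod_power_distrib\<close>)
  \<comment> \<open>The points are chosen independently, so the sum over the choices factors into
    line sums.\<close>
  also have "\<dots> = (\<Sum>j<N. \<psi> \<beta> ^ j * (\<Prod>i<m. line_sum j (x i)))"
  proof (intro sum.cong refl)
    fix j
    have "(\<Sum>c\<in>P. \<Prod>i<m. \<psi> (c i) ^ j) = (\<Prod>i<m. line_sum j (x i))"
      unfolding P_def line_sum_def by (rule prod_sum_PiE[symmetric])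
        (use subspD(3)[OF subsp_line_of] xK in auto)
    then show "(\<Sum>c\<in>P. \<psi> \<beta> ^ j * (\<Prod>i<m. \<psi> (c i) ^ j)) = \<psi> \<beta> ^ j * (\<Prod>i<m. line_sum j (x i))"
      by (simp add: sum_distrib_left[symmetric])
  qed
  also have "\<dots> = (\<Prod>i<m. line_sum 0 (x i)) + (\<Sum>j\<in>{0<..<N}. \<psi> \<beta> ^ j * (\<Prod>i<m. line_sum j (x i)))"
  proof -
    have "{..<N} = insert 0 {0<..<N}" using N_pos by auto
    then show ?thesis by simp
  qed
  also have "(\<Prod>i<m. line_sum 0 (x i)) = (\<Prod>i<m. of_real (real q ^ 2 - 1))"
  proof (rule prod.cong[OF refl])
    fix i assume "i \<in> {..<m}"
    then have i: "x i \<in> K - F" using xK by simp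
    have "card (line_of (x i) - {0}) = q ^ 2 - 1"
      using card_line_of[OF i] subspD[OF subsp_line_of] i by (simp add: card_Diff_singleton)
    then show "line_sum 0 (x i) = of_real (real q ^ 2 - 1)"
      using power_less_q[of 0 2] by (simp add: line_sum_def of_nat_diff)
  qed
  finally have "complex_of_real ((real q ^ 2 - 1) ^ m) =
      - (\<Sum>j\<in>{0<..<N}. \<psi> \<beta> ^ j * (\<Prod>i<m. line_sum j (x i)))"
    by (simp add: eq_neg_iff_add_eq_0)
  then have "norm (complex_of_real ((real q ^ 2 - 1) ^ m)) =
      norm (\<Sum>j\<in>{0<..<N}. \<psi> \<beta> ^ j * (\<Prod>i<m. line_sum j (x i)))"
    by simp
  moreover have "norm (complex_of_real ((real q ^ 2 - 1) ^ m)) = (real q ^ 2 - 1) ^ m"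
    unfolding norm_of_real using q3 by simp
  ultimately have "(real q ^ 2 - 1) ^ m = norm (\<Sum>j\<in>{0<..<N}. \<psi> \<beta> ^ j * (\<Prod>i<m. line_sum j (x i)))"
    by simp
  also have "\<dots> \<le> (\<Sum>j\<in>{0<..<N}. norm (\<psi> \<beta> ^ j * (\<Prod>i<m. line_sum j (x i))))" by (rule norm_sum)
  also have "\<dots> = (\<Sum>j\<in>{0<..<N}. \<Prod>i<m. norm (line_sum j (x i)))"
    by (simp add: norm_mult norm_power norm_psi prod_norm)
  also have "\<dots> \<le> (\<Sum>j\<in>{0<..<N}. sqrt (((real q - 1) ^ 2 * (real q + 1)) ^ m))"
  proof (rule sum_mono)
    fix j assume j: "j \<in> {0<..<N}"
    \<comment> \<open>The exact mean of the squared norms of the \<open>m\<close> line sums.\<close>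
    define A where "A = (real q - 1) ^ 2 * ((real q ^ 2 + 1) * (real q + 1) - 1) / m"
    have m0: "real m > 0" by (simp add: m_def add_pos_nonneg)
    have "(real q ^ 2 + 1) * (real q + 1) - 1 = real q ^ 3 + real q ^ 2 + real q"
      by (simp add: eval_nat_numeral algebra_simps)
    also have "\<dots> > 0" using q3 by (intro add_pos_pos) auto
    finally have A: "A > 0" unfolding A_def using q3 m0 by simp
    have "(\<Prod>i<m. (norm (line_sum j (x i))) ^ 2) \<le> A ^ card {..<m}"
    proof (rule prod_le_mean_power)
      show "(\<Sum>i<m. (norm (line_sum j (x i))) ^ 2) = card {..<m} * A"
        using sum_norm_line_sum[OF x] j m0 unfolding A_def m_def[symmetric] by simp
    qed (use A in auto)
    also have "\<dots> \<le> ((real q - 1) ^ 2 * (real q + 1)) ^ m"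
    proof -
      have "A \<le> (real q - 1) ^ 2 * (real q + 1)"
      proof -
        have "((real q ^ 2 + 1) * (real q + 1) - 1) / m \<le> real q + 1"
          using m0 by (simp add: m_def divide_le_eq algebra_simps)
        then show ?thesis unfolding A_def times_divide_eq_right[symmetric] by (intro mult_left_mono) auto
      qed
      then show ?thesis using A by (simp add: power_mono)
    qed
    finally have "(\<Prod>i<m. norm (line_sum j (x i))) ^ 2 \<le> ((real q - 1) ^ 2 * (real q + 1)) ^ m"
      by (simp add: prod_power_distrib)
    then show "(\<Prod>i<m. norm (line_sum j (x i))) \<le> sqrt (((real q - 1) ^ 2 * (real q + 1)) ^ m)"
      by (rule real_le_rsqrt)
  qed
  also have "\<dots> = real (N - 1) * sqrt (((real q - 1) ^ 2 * (real q + 1)) ^ m)" by simp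
  finally have "((real q ^ 2 - 1) ^ m) ^ 2 \<le> (real (N - 1) * sqrt (((real q - 1) ^ 2 * (real q + 1)) ^ m)) ^ 2"
    using q3 by (intro power_mono) auto
  also have "\<dots> = real (N - 1) ^ 2 * ((real q - 1) ^ 2 * (real q + 1)) ^ m"
    using q3 by (simp add: power_mult_distrib)
  \<comment> \<open>The main term exceeds the bound on each other term by the factor
    \<open>sqrt ((q + 1) ^ m)\<close>, which \<open>N - 1\<close> such terms would have to make up
    for.\<close>
  also have "((real q ^ 2 - 1) ^ m) ^ 2 = (real q + 1) ^ m * ((real q - 1) ^ 2 * (real q + 1)) ^ m"
  proof -
    have "((real q ^ 2 - 1) ^ m) ^ 2 = ((real q ^ 2 - 1) ^ 2) ^ m" by (simp add: power_mult[symmetric] mult.commute)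
    also have "(real q ^ 2 - 1) ^ 2 = (real q + 1) * ((real q - 1) ^ 2 * (real q + 1))"
      by (simp add: eval_nat_numeral algebra_simps)
    finally show ?thesis by (simp add: power_mult_distrib)
  qed
  finally have "(real q + 1) ^ m \<le> real (N - 1) ^ 2"
    using q3 by (simp add: mult_le_cancel_right)
  moreover have "real (N - 1) < (real q + 1) ^ 4"
    by (simp add: N_def eval_nat_numeral algebra_simps add_pos_nonneg)
  then have "real (N - 1) ^ 2 < ((real q + 1) ^ 4) ^ 2" by (intro power_strict_mono) auto
  moreover have "((real q + 1) ^ 4) ^ 2 \<le> (real q + 1) ^ m"
  proof -
    \<comment> \<open>For \<open>q \<ge> 3\<close> the exponent \<open>m = q ^ 2 + 1\<close> is at
      least 10 and so exceeds 8.\<close>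
    have "3 ^ 2 \<le> q ^ 2" using q3 by (intro power_mono) auto
    then have "(real q + 1) ^ 8 \<le> (real q + 1) ^ m" by (intro power_increasing) (auto simp: m_def)
    then show ?thesis by (simp add: power_mult[symmetric])
  qed
  ultimately show False by linarith
qed

section \<open>Generators of the quotient group\<close>

definition generates :: "'b \<Rightarrow> bool" where
  "generates v \<longleftrightarrow> v \<in> K - {0} \<and> (\<forall>h\<in>K - {0}. \<exists>k. \<exists>f\<in>F. h = f * v ^ k)"

lemma generates_reduce:
  assumes v: "generates v" and h: "h \<in> K - {0}"
  obtains k f where "k < N" "f \<in> F - {0}" "h = f * v ^ k"
proof -
  have v': "v \<in> K - {0}" using v by (simp add: generates_def)
  then obtain l where l: "v = \<alpha> ^ l" using gen by auto
  have vN: "v ^ N \<in> F" by (simp add: l power_mult[symmetric] gen_power_in_F_iff)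
  obtain k f where kf: "f \<in> F" "h = f * v ^ k" using v h unfolding generates_def by blast
  have "v ^ k = v ^ (N * (k div N) + k mod N)" by simp
  also have "\<dots> = (v ^ N) ^ (k div N) * v ^ (k mod N)" by (simp only: power_add power_mult)
  finally have "h = (f * (v ^ N) ^ (k div N)) * v ^ (k mod N)" using kf by simp
  moreover have "f * (v ^ N) ^ (k div N) \<in> F - {0}" using kf vN v' h by auto
  ultimately show ?thesis using that N_pos mod_less_divisor by blast
qed

text \<open>The order of \<open>v\<close> modulo \<open>F\<close> is exactly \<open>N\<close>: the
  pairs of a nonzero scalar and an exponent below \<open>N\<close> map onto the nonzero elements of
  \<open>K\<close> and are equally many. The pairs \<open>(1, k)\<close> and
  \<open>(v ^ k, 0)\<close> have the same image.\<close>

lemma generates_power_in_F: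
  assumes v: "generates v" and k: "k < N" "v ^ k \<in> F"
  shows "k = 0"
proof -
  have v': "v \<in> K - {0}" using v by (simp add: generates_def)
  define g where "g = (\<lambda>(f, k). f * v ^ k)"
  have "g ` ((F - {0}) \<times> {..<N}) = K - {0}"
  proof (intro equalityI subsetI)
    fix h assume "h \<in> K - {0}"
    from generates_reduce[OF v this] obtain k f where "k < N" "f \<in> F - {0}" "h = f * v ^ k" .
    then show "h \<in> g ` ((F - {0}) \<times> {..<N})" by (auto simp: g_def)
  qed (use v' in \<open>auto simp: g_def\<close>)
  moreover have "card ((F - {0}) \<times> {..<N}) = card (K - {0})"
    using N_mult by (simp add: card_cartesian_product card_Diff_singleton card_F card_K mult.commute)
  ultimately have "inj_on g ((F - {0}) \<times> {..<N})" by (intro eq_card_imp_inj_on) auto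
  moreover have "g (1, k) = g (v ^ k, 0)" by (simp add: g_def)
  moreover have "(1, k) \<in> (F - {0}) \<times> {..<N}" "(v ^ k, 0) \<in> (F - {0}) \<times> {..<N}"
    using k N_pos v' by auto
  ultimately have "(1, k) = (v ^ k, 0)" by (meson inj_onD)
  then show ?thesis by simp
qed

lemma generates_scale_gen:
  assumes "f \<in> F - {0}" shows "generates (\<alpha> / f)"
  unfolding generates_def
proof (intro conjI ballI)
  show "\<alpha> / f \<in> K - {0}" using assms gen_K by auto
  fix h assume "h \<in> K - {0}"
  then obtain k where "h = \<alpha> ^ k" using gen by auto
  then have "h = f ^ k * (\<alpha> / f) ^ k" using assms by (simp add: power_divide)
  moreover have "f ^ k \<in> F" using assms by simp
  ultimately show "\<exists>k. \<exists>g\<in>F. h = g * (\<alpha> / f) ^ k" by blast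
qed

text \<open>The Fourier estimate is too weak for \<open>q = 2\<close>, but then \<open>N = 31\<close> is prime.\<close>

lemma generating_voltage:
  assumes x: "transversal x" and w: "w \<in> K - {0}"
  shows "\<exists>c. (\<forall>i<q ^ 2 + 1. c i \<in> line_of (x i) - {0}) \<and> generates (w / (\<Prod>i<q ^ 2 + 1. c i))"
proof (cases "q = 2")
  case False
  then have q3: "3 \<le> q" using q_ge_2 by simp
  \<comment> \<open>With this constant the scaling factor becomes \<alpha> up to a scalar from
    \<open>F\<close>.\<close>
  have "\<alpha> / w \<in> K - {0}" using w gen_K by auto
  from prod_points_meets_F[OF x q3 this] obtain c where
    c: "\<And>i. i < q ^ 2 + 1 \<Longrightarrow> c i \<in> line_of (x i) - {0}"
    and F: "\<alpha> / w * (\<Prod>i<q ^ 2 + 1. c i) \<in> F" by blast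
  define f where "f = \<alpha> / w * (\<Prod>i<q ^ 2 + 1. c i)"
  have p0: "(\<Prod>i<q ^ 2 + 1. c i) \<noteq> 0" using c by (simp add: prod_zero_iff)
  then have f0: "f \<noteq> 0" using w gen_K by (simp add: f_def)
  have "w / (\<Prod>i<q ^ 2 + 1. c i) = \<alpha> / f" using w gen_K p0 by (simp add: f_def field_simps)
  moreover have "f \<in> F - {0}" using F f0 by (simp add: f_def)
  ultimately have "generates (w / (\<Prod>i<q ^ 2 + 1. c i))" using generates_scale_gen by simp
  then show ?thesis using c by blast
next
  case True
  have cF: "F = {0, 1}"
    by (rule card_seteq[symmetric]) (use card_F True in auto)
  have gen2: "generates v" if v: "v \<in> K - {0}" "v \<noteq> 1" for v
    unfolding generates_def
  proof (intro conjI ballI)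
    show "v \<in> K - {0}" by fact
    fix h assume "h \<in> K - {0}"
    then obtain l where l: "h = \<alpha> ^ l" using gen by auto
    obtain k where k: "v = \<alpha> ^ k" using gen v by auto
    have a31: "\<alpha> ^ n = 1 \<longleftrightarrow> 31 dvd n" for n using gen_power_eq_1_iff[of n] True by simp
    have prime: "normalization_semidom_class.prime (31::nat)" by (simp add: prime_nat_numeral_eq)
    have "\<not> 31 dvd k" using v k a31 by auto
    from prime_imp_coprime[OF prime this] have "coprime k 31" by (simp add: coprime_commute)
    \<comment> \<open>The inverse \<open>t\<close> of \<open>k\<close> modulo 31 recovers \<alpha>
      as \<open>v ^ t\<close>.\<close>
    then obtain t where "[k * t = 1] (mod 31)" using cong_solve_coprime_nat by auto
    then have t: "(k * t) mod 31 = 1" by (simp add: Cong.cong_def)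
    have "\<alpha> ^ (k * t) = \<alpha> ^ (31 * (k * t div 31) + k * t mod 31)" by simp
    also have "\<dots> = \<alpha> ^ (31 * (k * t div 31)) * \<alpha>" unfolding power_add t by simp
    also have "\<alpha> ^ (31 * (k * t div 31)) = 1" unfolding a31 by simp
    finally have "\<alpha> ^ (k * t) = \<alpha>" by simp
    moreover have "v ^ (t * l) = (\<alpha> ^ (k * t)) ^ l" by (simp add: k power_mult[symmetric] mult.assoc)
    ultimately have "v ^ (t * l) = h" by (simp add: l)
    then show "\<exists>k. \<exists>f\<in>F. h = f * v ^ k" by (intro exI[of _ "t * l"] bexI[of _ 1]) auto
  qed
  show ?thesis
  \<comment> \<open>The point 1 on every line gives the factor \<open>w\<close>. If this is trivial,
    the point \<open>x 0\<close> on the first line changes it to \<open>1 / x 0\<close>.\<close>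
  proof (cases "w = 1")
    case False
    then show ?thesis using gen2[of w] w one_line_of by (intro exI[of _ "\<lambda>_. 1"]) auto
  next
    case True
    have x0: "x 0 \<in> K - F" using x by (simp add: transversal_def)
    then have ne: "x 0 \<noteq> 1" "x 0 \<noteq> 0" by auto
    define c where "c = (\<lambda>i::nat. if i = 0 then x 0 else 1)"
    have "(\<Prod>i<q ^ 2 + 1. c i) = x 0"
      by (simp add: c_def prod.If_cases)
    moreover have "generates (w / x 0)" by (rule gen2) (use True x0 ne in auto)
    moreover have "\<forall>i<q ^ 2 + 1. c i \<in> line_of (x i) - {0}"
      using one_line_of self_line_of ne by (auto simp: c_def)
    ultimately show ?thesis by metis
  qed
qed


section \<open>Lifting the cycle\<close>

text \<open>A nonzero denominator \<open>w\<close> of the ratio \<open>z\<close> in the plane places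
  both \<open>w\<close> and \<open>z * w\<close> in it, hence the whole scaled line. So every plane
  contains a member of every line orbit.\<close>

lemma edge_exists:
  assumes y: "y \<in> K - F" and z: "z \<in> K - F"
  shows "\<exists>w\<in>K - {0}. (*) w ` line_of z \<subseteq> plane_of y"
proof -
  have W: "subsp (plane_of y)" "card (plane_of y) = q ^ 3" using subsp_plane_of card_plane_of y by auto
  note W' = subspD[OF W(1)]
  have "ratio_count (plane_of y) z > 0" using ratio_count_plane_ge[OF W z] q_ge_2 by simp
  then have "ratio_space (plane_of y) z - {0} \<noteq> {}" unfolding ratio_count_def by (metis card.empty less_irrefl)
  then obtain w where w: "w \<in> plane_of y" "z * w \<in> plane_of y" "w \<noteq> 0"
    by (auto simp: ratio_space_def)
  have "(*) w ` line_of z \<subseteq> plane_of y"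
  proof
    fix u assume "u \<in> (*) w ` line_of z"
    then obtain f g where fg: "f \<in> F" "g \<in> F" "u = w * (f + g * z)" by (auto elim!: line_ofE)
    then have "u = f * w + g * (z * w)" by (simp add: algebra_simps)
    then show "u \<in> plane_of y" using W' w fg by simp
  qed
  then show ?thesis using w W' by blast
qed

lemma scale_F:
  assumes W: "subsp W" and f: "f \<in> F - {0}"
  shows "(*) f ` W = W"
proof (rule card_subset_eq)
  show "finite W" "(*) f ` W \<subseteq> W" using subspD[OF W] f by auto
  show "card ((*) f ` W) = card W" using card_scale f by simp
qed

lemma generates_power_N: assumes "generates v" shows "v ^ N \<in> F - {0}"
proof -
  have v: "v \<in> K - {0}" using assms by (simp add: generates_def)
  then obtain l where "v = \<alpha> ^ l" using gen by auto
  then have "v ^ N \<in> F" by (simp add: power_mult[symmetric] gen_power_in_F_iff)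
  then show ?thesis using v by simp
qed

lemma scale_cancel:
  fixes a b :: 'b
  assumes "a \<noteq> 0" "(*) a ` A = (*) b ` B" shows "A = (*) (b / a) ` B"
  using scale_eq_iff[OF assms(1), of A "(*) b ` B"] assms(2) by (simp add: image_image)

text \<open>If a family of pairwise inequivalent subspaces is traversed periodically while the scaling
  factor gains a generator of \<open>K\<^sup>*/F\<^sup>*\<close> in each period, then every multiple of every
  member of the family is met exactly once in the first \<open>m * N\<close> steps.\<close>

lemma bij_betw_orbit_traversal:
  fixes T :: "nat \<Rightarrow> 'b set" and g :: "nat \<Rightarrow> 'b"
  assumes m: "0 < m" and v: "generates v"
    and T: "\<And>i. i < m \<Longrightarrow> subsp (T i) \<and> (card (T i) = q ^ 2 \<or> card (T i) = q ^ 3)"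
    and ineq: "\<And>i j a. i < m \<Longrightarrow> j < m \<Longrightarrow> a \<in> K - {0} \<Longrightarrow> T i = (*) a ` T j \<Longrightarrow> i = j"
    and g: "\<And>t. g t \<in> K - {0}" "\<And>t. g (t + m) = v * g t"
  shows "bij_betw (\<lambda>t. (*) (g t) ` T (t mod m)) {..<m * N} {(*) h ` T i |h i. h \<in> K - {0} \<and> i < m}"
proof -
  have v': "v \<in> K - {0}" using v by (simp add: generates_def)
  have g_add: "g (t + k * m) = v ^ k * g t" for t k
  proof (induction k)
    case (Suc k)
    have "g (t + Suc k * m) = g ((t + k * m) + m)" by (simp add: algebra_simps)
    then show ?case using g(2) Suc by simp
  qed simp
  have decomp: "g t = v ^ (t div m) * g (t mod m)" for t
    using g_add[of "t mod m" "t div m"] by simp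
  have eq: "s = t" if st: "s \<le> t" "s < m * N" "t < m * N"
    "(*) (g s) ` T (s mod m) = (*) (g t) ` T (t mod m)" for s t
  proof -
    have "T (s mod m) = (*) (g t / g s) ` T (t mod m)" using scale_cancel st(4) g(1) by blast
    moreover have "g t / g s \<in> K - {0}" using g(1)[of s] g(1)[of t] by simp
    ultimately have mod: "s mod m = t mod m" by (intro ineq) (use m in auto)
    define A where "A = T (s mod m)"
    have A: "subsp A" "card A = q ^ 2 \<or> card A = q ^ 3" using T m by (auto simp: A_def)
    \<comment> \<open>With equal residues the factors differ only by the completed periods, so a
      power of \<open>v\<close> with exponent below \<open>N\<close> stabilizes
      \<open>A\<close>.\<close>
    have "g t / g s = v ^ (t div m) / v ^ (s div m)"
      using decomp[of s] decomp[of t] mod g(1)[of "s mod m"] by simp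
    also have "\<dots> = v ^ (t div m - s div m)" using v' div_le_mono[OF st(1)] by (simp add: power_diff)
    finally have "(*) (v ^ (t div m - s div m)) ` A = A"
      using \<open>T (s mod m) = _\<close> mod by (simp add: A_def)
    then have "v ^ (t div m - s div m) \<in> F" using scaling_stabilizer[OF A] v' by simp
    moreover have "t div m < N" using st(3) m by (simp add: less_mult_imp_div_less mult.commute)
    ultimately have "t div m - s div m = 0" using generates_power_in_F[OF v, of "t div m - s div m"]
      by (simp add: less_imp_diff_less)
    then have "t div m = s div m" using div_le_mono[OF st(1), of m] by simp
    then show "s = t" using mod by (metis div_mult_mod_eq)
  qed
  have inj: "inj_on (\<lambda>t. (*) (g t) ` T (t mod m)) {..<m * N}"
  proof (rule inj_onI)
    fix s t assume "s \<in> {..<m * N}" "t \<in> {..<m * N}" "(*) (g s) ` T (s mod m) = (*) (g t) ` T (t mod m)"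
    then show "s = t" using eq[of s t] eq[of t s] by (cases "s \<le> t") auto
  qed
  moreover have "(\<lambda>t. (*) (g t) ` T (t mod m)) ` {..<m * N} = {(*) h ` T i |h i. h \<in> K - {0} \<and> i < m}"
  proof (intro equalityI subsetI)
    fix Y assume "Y \<in> (\<lambda>t. (*) (g t) ` T (t mod m)) ` {..<m * N}"
    then obtain t where "Y = (*) (g t) ` T (t mod m)" by auto
    moreover have "t mod m < m" using m by simp
    ultimately show "Y \<in> {(*) h ` T i |h i. h \<in> K - {0} \<and> i < m}" using g(1)[of t] by blast
  next
    fix Y assume "Y \<in> {(*) h ` T i |h i. h \<in> K - {0} \<and> i < m}"
    then obtain h i where hi: "h \<in> K - {0}" "i < m" "Y = (*) h ` T i" by auto
    then have "h / g i \<in> K - {0}" using g(1)[of i] by simp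
    from generates_reduce[OF v this] obtain k f where k: "k < N" "f \<in> F - {0}" "h / g i = f * v ^ k" .
    have "h = g (i + k * m) * f" using k(3) g(1)[of i] by (simp add: g_add field_simps)
    then have "Y = (*) (g (i + k * m)) ` ((*) f ` T i)" using hi(3) by (simp add: image_image mult.assoc)
    also have "(*) f ` T i = T i" using scale_F T hi(2) k(2) by blast
    finally have "Y = (*) (g (i + k * m)) ` T ((i + k * m) mod m)" using hi(2) by simp
    moreover have "i + k * m < m * N"
    proof -
      have "i + k * m < Suc k * m" using hi(2) by simp
      also have "\<dots> \<le> N * m" using k(1) by (intro mult_le_mono1) simp
      finally show ?thesis by (simp add: mult.commute)
    qed
    ultimately show "Y \<in> (\<lambda>t. (*) (g t) ` T (t mod m)) ` {..<m * N}" by blast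
  qed
  ultimately show ?thesis by (simp add: bij_betw_def)
qed

text \<open>Squaring a line squares its scaling factor, so equivalent lines have equivalent
  squares.\<close>

lemma plane_of_ratio_class:
  assumes x: "x \<in> K - F" and r: "r \<in> ratio_class x"
  obtains b where "b \<in> K - {0}" "line_of x = (*) b ` line_of r" "plane_of x = (*) (b * b) ` plane_of r"
proof -
  have rK: "r \<in> K - F" using r ratio_class_subset by auto
  then obtain b where b: "b \<in> K" "b \<noteq> 0" "line_of x = (*) b ` line_of r"
    using ratio_class_iff[OF x] r by auto
  have bl: "b \<in> line_of x" "b * r \<in> line_of x"
    unfolding b(3) using one_line_of[of r] self_line_of[of r] by force+
  have "b * b \<in> plane_of x" "b * b * r \<in> plane_of x" "b * b * r ^ 2 \<in> plane_of x"
    using line_of_mult_line_of[OF bl(1) bl(1)] line_of_mult_line_of[OF bl(1) bl(2)]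
      line_of_mult_line_of[OF bl(2) bl(2)] by (simp_all add: power2_eq_square mult_ac)
  then have "plane_of x = (*) (b * b) ` plane_of r"
    using plane_eq[of "plane_of x" r "b * b"] subsp_plane_of card_plane_of x rK b(2) by auto
  then show ?thesis using that b by simp
qed

text \<open>\<open>line_form\<close> and \<open>plane_form\<close> reduce any line or plane to some
  \<open>r\<close>, and the representative of the class of \<open>r\<close> differs from it by
  \<open>b\<close> on lines and \<open>b * b\<close> on planes.\<close>

lemma transversal_orbits:
  assumes x: "transversal x"
  shows "{(*) h ` line_of (x i) |h i. h \<in> K - {0} \<and> i < q ^ 2 + 1} = {W. subsp W \<and> card W = q ^ 2}"
    "{(*) h ` plane_of (x i) |h i. h \<in> K - {0} \<and> i < q ^ 2 + 1} = {W. subsp W \<and> card W = q ^ 3}"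
proof -
  have xK: "x i \<in> K - F" if "i < q ^ 2 + 1" for i using x that by (simp add: transversal_def)
  have rep: "\<exists>i b. i < q ^ 2 + 1 \<and> b \<in> K - {0} \<and> line_of (x i) = (*) b ` line_of r \<and>
      plane_of (x i) = (*) (b * b) ` plane_of r" if r: "r \<in> K - F" for r
  proof -
    have "ratio_class r \<in> (\<lambda>i. ratio_class (x i)) ` {..<q ^ 2 + 1}"
      using x r unfolding transversal_def bij_betw_def by blast
    then obtain i where i: "i < q ^ 2 + 1" "ratio_class r = ratio_class (x i)" by auto
    then have "r \<in> ratio_class (x i)" using self_ratio_class[OF r] by simp
    from plane_of_ratio_class[OF xK[OF i(1)] this] i(1) show ?thesis by metis
  qed
  show "{(*) h ` line_of (x i) |h i. h \<in> K - {0} \<and> i < q ^ 2 + 1} = {W. subsp W \<and> card W = q ^ 2}"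
  proof (intro equalityI subsetI)
    fix W assume "W \<in> {(*) h ` line_of (x i) |h i. h \<in> K - {0} \<and> i < q ^ 2 + 1}"
    then obtain h i where "h \<in> K - {0}" "i < q ^ 2 + 1" "W = (*) h ` line_of (x i)" by auto
    then show "W \<in> {W. subsp W \<and> card W = q ^ 2}"
      using xK[of i] subsp_scale[OF subsp_line_of] card_line_of[of "x i"] card_scale[of h] by auto
  next
    fix W assume "W \<in> {W. subsp W \<and> card W = q ^ 2}"
    then have "subsp W" "card W = q ^ 2" by auto
    from line_form[OF this] obtain a r where a: "a \<in> K" "a \<noteq> 0" "r \<in> K - F" "W = (*) a ` line_of r" .
    from rep[OF a(3)] obtain i b where b: "i < q ^ 2 + 1" "b \<in> K - {0}" "line_of (x i) = (*) b ` line_of r"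
      by blast
    then have "W = (*) (a / b) ` line_of (x i)" using a by (simp add: image_image)
    moreover have "a / b \<in> K - {0}" using a b by simp
    ultimately show "W \<in> {(*) h ` line_of (x i) |h i. h \<in> K - {0} \<and> i < q ^ 2 + 1}" using b(1) by blast
  qed
  show "{(*) h ` plane_of (x i) |h i. h \<in> K - {0} \<and> i < q ^ 2 + 1} = {W. subsp W \<and> card W = q ^ 3}"
  proof (intro equalityI subsetI)
    fix W assume "W \<in> {(*) h ` plane_of (x i) |h i. h \<in> K - {0} \<and> i < q ^ 2 + 1}"
    then obtain h i where "h \<in> K - {0}" "i < q ^ 2 + 1" "W = (*) h ` plane_of (x i)" by auto
    then show "W \<in> {W. subsp W \<and> card W = q ^ 3}"
      using xK[of i] subsp_scale[OF subsp_plane_of] card_plane_of[of "x i"] card_scale[of h] by auto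
  next
    fix W assume "W \<in> {W. subsp W \<and> card W = q ^ 3}"
    then have "subsp W" "card W = q ^ 3" by auto
    from plane_form[OF this] obtain a r where a: "a \<in> K" "a \<noteq> 0" "r \<in> K - F" "W = (*) a ` plane_of r" .
    from rep[OF a(3)] obtain i b where b: "i < q ^ 2 + 1" "b \<in> K - {0}"
      "plane_of (x i) = (*) (b * b) ` plane_of r" by blast
    then have "W = (*) (a / (b * b)) ` plane_of (x i)" using a by (simp add: image_image)
    moreover have "a / (b * b) \<in> K - {0}" using a b by simp
    ultimately show "W \<in> {(*) h ` plane_of (x i) |h i. h \<in> K - {0} \<and> i < q ^ 2 + 1}" using b(1) by blast
  qed
qed

text \<open>The quotient cycle through the \<open>m\<close> orbits is unrolled \<open>N\<close>
  times, with consecutive lines joined by a common plane.\<close>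

lemma line_plane_cycle:
  obtains L P :: "nat \<Rightarrow> 'b set" and n where "2 \<le> n" "L n = L 0"
    "\<And>t. L t \<subseteq> P t" "\<And>t. L (Suc t) \<subseteq> P t"
    "bij_betw L {..<n} {W. subsp W \<and> card W = q ^ 2}"
    "bij_betw P {..<n} {W. subsp W \<and> card W = q ^ 3}"
proof -
  define m where "m = q ^ 2 + 1"
  have m: "0 < m" by (simp add: m_def)
  obtain x where x: "transversal x" using transversal_exists by blast
  have xK: "x i \<in> K - F" if "i < m" for i using x that by (simp add: transversal_def m_def)
  have "\<exists>w. w \<in> K - {0} \<and> (*) w ` line_of (x (Suc i mod m)) \<subseteq> plane_of (x i)" if "i < m" for i
    using edge_exists[OF xK[OF that] xK[of "Suc i mod m"]] m by auto
  then obtain w where w: "\<And>i. i < m \<Longrightarrow> w i \<in> K - {0}"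
    "\<And>i. i < m \<Longrightarrow> (*) (w i) ` line_of (x (Suc i mod m)) \<subseteq> plane_of (x i)" by metis
  have "(\<Prod>i<m. w i) \<in> K - {0}" using psi_prod[of "{..<m}" w] w(1) by simp
  from generating_voltage[OF x this] obtain c where
    c: "\<And>i. i < m \<Longrightarrow> c i \<in> line_of (x i) - {0}" and v: "generates ((\<Prod>i<m. w i) / (\<Prod>i<m. c i))"
    unfolding m_def by blast
  have cK: "c i \<in> K - {0}" if "i < m" for i using c[OF that] subspD(1)[OF subsp_line_of] xK[OF that] by blast
  define v where "v = (\<Prod>i<m. w i) / (\<Prod>i<m. c i)"
  \<comment> \<open>Passing from a line to its square divides the factor by the point
    \<open>c\<close>; passing on to the next line multiplies it by \<open>w\<close>.\<close>
  define g where "g = rec_nat 1 (\<lambda>t y. y * (w (t mod m) / c (t mod m)))"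
  have g_0: "g 0 = 1" and g_Suc: "g (Suc t) = g t * (w (t mod m) / c (t mod m))" for t
    by (simp_all add: g_def)
  have gK: "g t \<in> K - {0}" for t
  proof (induction t)
    case (Suc t)
    have "t mod m < m" using m by simp
    then show ?case using Suc w(1)[of "t mod m"] cK[of "t mod m"] by (simp add: g_Suc)
  qed (simp add: g_0)
  have "g t = (\<Prod>i<t. w i / c i)" if "t \<le> m" for t
    using that by (induction t) (simp_all add: g_0 g_Suc)
  then have g_m: "g m = v" by (simp add: v_def prod_dividef)
  have g_add: "g (t + m) = v * g t" for t
  proof (induction t)
    case 0 then show ?case by (simp add: g_m g_0)
  next
    case (Suc t)
    have "g (Suc t + m) = g (t + m) * (w ((t + m) mod m) / c ((t + m) mod m))"
      by (simp only: add_Suc g_Suc)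
    also have "(t + m) mod m = t mod m" by simp
    finally show ?case by (simp add: Suc g_Suc)
  qed
  define L where "L = (\<lambda>t. (*) (g t) ` line_of (x (t mod m)))"
  \<comment> \<open>Division by \<open>c\<close> turns the inclusion of \<open>c\<close> times the
    line in its square into \<open>L t \<subseteq> P t\<close>.\<close>
  define P where "P = (\<lambda>t. (*) (g t / c (t mod m)) ` plane_of (x (t mod m)))"
  have inj: "i = j" if "i < m" "j < m" "x i \<in> ratio_class (x j)" for i j
  proof -
    have "ratio_class (x i) = ratio_class (x j)" using ratio_class_eq xK that by blast
    then show ?thesis using x that by (auto simp: transversal_def bij_betw_def inj_on_def m_def)
  qed
  have bijL: "bij_betw L {..<m * N} {W. subsp W \<and> card W = q ^ 2}"
    unfolding L_def transversal_orbits(1)[OF x, symmetric] m_def[symmetric]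
  proof (rule bij_betw_orbit_traversal[where T = "\<lambda>i. line_of (x i)" and v = v])
    show "generates v" using v by (simp add: v_def)
    show "subsp (line_of (x i)) \<and> (card (line_of (x i)) = q ^ 2 \<or> card (line_of (x i)) = q ^ 3)"
      if "i < m" for i using subsp_line_of card_line_of xK[OF that] by auto
    show "i = j" if "i < m" "j < m" "a \<in> K - {0}" "line_of (x i) = (*) a ` line_of (x j)" for i j a
    proof -
      have "x j \<in> ratio_class (x i)" using ratio_class_iff[OF xK[OF that(1)] xK[OF that(2)]] that by blast
      then show ?thesis using inj that by metis
    qed
  qed (use m gK g_add in auto)
  have bijP: "bij_betw P {..<m * N} {W. subsp W \<and> card W = q ^ 3}"
    unfolding P_def transversal_orbits(2)[OF x, symmetric] m_def[symmetric]
  proof (rule bij_betw_orbit_traversal[where T = "\<lambda>i. plane_of (x i)" and v = v])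
    show "generates v" using v by (simp add: v_def)
    show "subsp (plane_of (x i)) \<and> (card (plane_of (x i)) = q ^ 2 \<or> card (plane_of (x i)) = q ^ 3)"
      if "i < m" for i using subsp_plane_of card_plane_of xK[OF that] by auto
    show "i = j" if "i < m" "j < m" "a \<in> K - {0}" "plane_of (x i) = (*) a ` plane_of (x j)" for i j a
    proof -
      have "x i \<in> ratio_class (x j)"
        using plane_of_scale_imp_ratio_class[OF xK[OF that(2)] xK[OF that(1)] _ that(4)] that(3) by simp
      then show ?thesis using inj that by metis
    qed
    show "g t / c (t mod m) \<in> K - {0}" for t using gK[of t] cK[of "t mod m"] m by simp
    show "g (t + m) / c ((t + m) mod m) = v * (g t / c (t mod m))" for t using g_add by simp
  qed (use m in auto)
  have LP: "L t \<subseteq> P t" for t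
  proof
    fix y assume "y \<in> L t"
    then obtain u where u: "u \<in> line_of (x (t mod m))" "y = g t * u" by (auto simp: L_def)
    have i: "t mod m < m" using m by simp
    have "c (t mod m) * u \<in> plane_of (x (t mod m))" using line_of_mult_line_of u(1) c[OF i] by blast
    moreover have "y = g t / c (t mod m) * (c (t mod m) * u)" using u c[OF i] by simp
    ultimately show "y \<in> P t" unfolding P_def by blast
  qed
  have LSP: "L (Suc t) \<subseteq> P t" for t
  proof
    fix y assume "y \<in> L (Suc t)"
    then obtain u where u: "u \<in> line_of (x (Suc t mod m))" "y = g (Suc t) * u" by (auto simp: L_def)
    have i: "t mod m < m" using m by simp
    have "w (t mod m) * u \<in> plane_of (x (t mod m))" using w(2)[OF i] u(1) by (auto simp: mod_Suc_eq)
    moreover have "y = g t / c (t mod m) * (w (t mod m) * u)" using u by (simp add: g_Suc)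
    ultimately show "y \<in> P t" unfolding P_def by blast
  qed
  have gN: "g (k * m) = v ^ k" for k
  proof (induction k)
    case (Suc k)
    then show ?case using g_add[of "k * m"] by (simp add: add.commute)
  qed (simp add: g_0)
  \<comment> \<open>After \<open>N\<close> periods the factor \<open>v ^ N\<close> lies in
    \<open>F\<close> and fixes the first line, so the walk closes.\<close>
  have "L (m * N) = (*) (v ^ N) ` line_of (x 0)" using gN[of N] by (simp add: L_def mult.commute)
  also have "\<dots> = line_of (x 0)"
  proof (rule scale_F[OF subsp_line_of])
    show "v ^ N \<in> F - {0}" using generates_power_N v unfolding v_def .
  qed (use xK[OF m] in auto)
  also have "\<dots> = L 0" by (simp add: L_def g_0)
  finally have "L (m * N) = L 0" .
  moreover have "2 \<le> m * N"
  proof -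
    have "1 * 2 \<le> m * N" using m q_ge_2 by (intro mult_le_mono) (auto simp: N_def)
    then show ?thesis by simp
  qed
  ultimately show ?thesis using that LP LSP bijL bijP by blast
qed

end

section \<open>Transfer to the coordinate space\<close>

text \<open>\<open>K\<close> is repackaged as a ring record to apply the cyclicity of the
  multiplicative group of a finite field.\<close>

lemma finite_subfield_generator:
  fixes K :: "'b::field set"
  assumes K: "finite_subfield K"
  obtains \<alpha> where "\<alpha> \<in> K" "\<alpha> \<noteq> 0" "\<And>x. x \<in> K \<Longrightarrow> x \<noteq> 0 \<Longrightarrow> \<exists>k::nat. x = \<alpha> ^ k"
proof -
  note KD = finite_subfieldD[OF K]
  define R :: "'b ring" where "R = \<lparr>carrier = K, monoid.mult = (\<lambda>x y. x * y), one = 1,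
    ring.zero = 0, add = (\<lambda>x y. x + y)\<rparr>"
  have inv: "\<exists>y\<in>K. y * x = 1 \<and> x * y = 1" if "x \<in> K" "x \<noteq> 0" for x
    using KD(8)[OF that(1)] that by (intro bexI[of _ "inverse x"]) auto
  have neg: "\<exists>y\<in>K. y + x = 0 \<and> x + y = 0" if "x \<in> K" for x
    using KD(6)[OF that] by (intro bexI[of _ "- x"]) auto
  interpret R: Ring.field R
    by unfold_locales (use KD inv neg in \<open>auto simp: R_def Units_def algebra_simps\<close>)
  have pow: "a [^]\<^bsub>R\<^esub> n = a ^ n" for a and n :: nat
    by (induction n) (simp_all add: R_def nat_pow_def mult.commute)
  from R.finite_field_mult_group_has_gen obtain a where
    "a \<in> carrier (mult_of R)" "carrier (mult_of R) = {a [^]\<^bsub>R\<^esub> i |i::nat. i \<in> UNIV}"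
    using KD(1) by (auto simp: R_def)
  then have "a \<in> K - {0}" "K - {0} = {a ^ i |i::nat. i \<in> UNIV}"
    unfolding pow by (auto simp: R_def)
  then show ?thesis using that[of a] by blast
qed

lemma proots_prod_linear_factors: "proots (\<Prod>x\<in>#A. [:- x, 1:]) = A"
  for A :: "'b::field multiset"
proof (induction A)
  case (add x A)
  have "(\<Prod>x\<in>#A. [:- x, 1:]) \<noteq> 0" by (auto simp: prod_mset_zero_iff)
  then show ?case using add by (simp add: proots_mult del: mult_pCons_left)
qed simp

text \<open>Over an algebraically closed field \<open>p\<close> splits, and a multiple root would
  also be a root of the derivative.\<close>

lemma card_separable_roots:
  fixes p :: "'b::alg_closed_field poly"
  assumes p: "p \<noteq> 0" and sep: "\<And>x. poly p x = 0 \<Longrightarrow> poly (pderiv p) x \<noteq> 0"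
  shows "card {x. poly p x = 0} = Polynomial.degree p"
proof -
  obtain A where A: "size A = Polynomial.degree p"
    "p = Polynomial.smult (Polynomial.lead_coeff p) (\<Prod>x\<in>#A. [:- x, 1:])"
    using alg_closed_imp_factorization[OF p] by auto
  have pr: "proots p = A"
    using proots_smult[of "Polynomial.lead_coeff p" "\<Prod>x\<in>#A. [:- x, 1:]"] p A(2)
    by (simp add: proots_prod_linear_factors)
  have "count A x = 1" if "x \<in># A" for x
  proof -
    have root: "poly p x = 0" using that set_count_proots[OF p] pr by auto
    have "\<not> 2 \<le> Polynomial.order x p"
    proof
      assume "2 \<le> Polynomial.order x p"
      then have "[:- x, 1:] ^ 2 dvd p" by (simp add: order_divides)
      then obtain s where "p = [:- x, 1:] ^ 2 * s" by (rule dvdE)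
      then have "p = [:- x, 1:] * ([:- x, 1:] * s)" by (simp only: power2_eq_square mult.assoc)
      then have "pderiv p = [:- x, 1:] * pderiv ([:- x, 1:] * s) + ([:- x, 1:] * s) * pderiv [:- x, 1:]"
        by (simp only: pderiv_mult)
      then have "poly (pderiv p) x = 0" by simp
      then show False using sep[OF root] by simp
    qed
    moreover have "Polynomial.order x p \<noteq> 0" using root p by (simp add: order_root)
    ultimately show ?thesis using count_proots[OF p, of x] pr by simp
  qed
  then have "size A = card (set_mset A)" by (simp add: size_multiset_overloaded_eq)
  then show ?thesis using A(1) set_count_proots[OF p] pr by simp
qed

lemma CHAR_of_card_primepow:
  assumes "primepow q" "CARD('a::{Fields.field, finite}) = q"
  obtains e where "q = CHAR('a::{Fields.field, finite}) ^ e" "e > 0"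
    "normalization_semidom_class.prime CHAR('a::{Fields.field, finite})"
proof -
  obtain p e where p: "normalization_semidom_class.prime p" "e > 0" "q = p ^ e"
    using assms(1) by (auto simp: primepow_def)
  have pos: "CHAR('a) > 0" by (rule finite_imp_CHAR_pos) simp
  have prime: "normalization_semidom_class.prime CHAR('a)" by (rule prime_CHAR_semidom[OF pos])
  \<comment> \<open>Translation by 1 permutes the field, so the cardinality is 0 in it and the
    characteristic divides \<open>p ^ e\<close>.\<close>
  have "(\<Sum>x\<in>(UNIV :: 'a set). x + 1) = (\<Sum>x\<in>UNIV. x)"
    by (rule sum.reindex_bij_witness[of _ "\<lambda>x. x - 1" "\<lambda>x. x + 1"]) auto
  then have "of_nat CARD('a) = (0::'a)" by (simp add: sum.distrib)
  then have "CHAR('a) dvd p ^ e" using assms(2) p(3) by (metis of_nat_eq_0_iff_char_dvd)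
  then have "CHAR('a) = p" using prime p(1) by (meson prime_dvd_power primes_dvd_imp_eq)
  then show ?thesis using that p by blast
qed

text \<open>\<open>K\<close> consists of the roots of \<open>X ^ (q ^ 5) - X\<close> in the
  algebraic closure: additivity of the power makes it a field, and the derivative -1 makes the roots
  distinct.\<close>

lemma quintic_extension_exists:
  assumes q: "primepow q" "CARD('a::{Fields.field, finite}) = q"
  obtains K :: "'a::{Fields.field, finite} alg_closure set" and \<alpha> where "quintic_extension (range to_ac) K \<alpha> q"
proof -
  obtain e where e: "q = CHAR('a) ^ e" "e > 0" and prime: "normalization_semidom_class.prime CHAR('a)"
    using CHAR_of_card_primepow[OF q] .
  define n where "n = q ^ 5"
  have n: "n = CHAR('a alg_closure) ^ (e * 5)" by (simp add: n_def e(1) power_mult)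
  have q2: "2 \<le> q"
  proof -
    have "card {0, 1::'a} \<le> CARD('a)" by (rule card_mono) auto
    then show ?thesis using q by simp
  qed
  have n2: "2 \<le> n"
  proof -
    have "2 ^ 1 \<le> (2::nat) ^ 5" by simp
    also have "\<dots> \<le> q ^ 5" using q2 by (rule power_mono) simp
    finally show ?thesis by (simp add: n_def)
  qed
  have add: "(x + y) ^ n = x ^ n + y ^ n" for x y :: "'a alg_closure"
    by (rule freshmans_dream'[OF _ n]) (use prime in simp)
  \<comment> \<open>Additivity at \<open>x\<close> and \<open>- x\<close> covers even and odd
    \<open>n\<close> at once.\<close>
  have minus: "(- x) ^ n = - (x ^ n)" for x :: "'a alg_closure"
    using add[of x "- x"] n2 by (simp add: eq_neg_iff_add_eq_0 add.commute power_0_left)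
  define K where "K = {x :: 'a alg_closure. x ^ n = x}"
  define p :: "'a alg_closure poly" where "p = Polynomial.monom 1 n - Polynomial.monom 1 1"
  have n0: "of_nat n = (0 :: 'a alg_closure)"
    using e(2) prime n by (simp add: of_nat_eq_0_iff_char_dvd)
  have pd: "pderiv p = [:- 1:]"
    using n0 by (simp add: p_def pderiv_diff pderiv_monom monom_0)
  then have p0: "p \<noteq> 0" by auto
  have degp: "Polynomial.degree p = n"
  proof -
    have "Polynomial.degree p = Polynomial.degree (Polynomial.monom (1 :: 'a alg_closure) n)"
      unfolding p_def diff_conv_add_uminus
      by (rule degree_add_eq_left) (use n2 in \<open>simp add: degree_monom_eq\<close>)
    then show ?thesis by (simp add: degree_monom_eq)
  qed
  have roots: "{x. poly p x = 0} = K" by (simp add: p_def K_def poly_monom)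
  have cardK: "card K = q ^ 5"
    using card_separable_roots[OF p0] pd degp roots by (simp add: n_def)
  have K: "finite_subfield K"
    unfolding finite_subfield_def
  proof (intro conjI ballI)
    show "finite K" using poly_roots_finite[OF p0] roots by simp
    show "1 \<in> K" by (simp add: K_def)
    show "x - y \<in> K" "x * y \<in> K" if "x \<in> K" "y \<in> K" for x y
      using that add[of x "- y"] minus[of y] by (simp_all add: K_def power_mult_distrib)
    show "inverse x \<in> K" if "x \<in> K" for x using that by (simp add: K_def power_inverse)
  qed
  have F: "finite_subfield (range (to_ac :: 'a \<Rightarrow> _))"
    unfolding finite_subfield_def
  proof (intro conjI ballI)
    show "finite (range (to_ac :: 'a \<Rightarrow> _))" by simp
    show "1 \<in> range (to_ac :: 'a \<Rightarrow> _)" by (metis rangeI to_ac_1)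
    show "x - y \<in> range to_ac" "x * y \<in> range to_ac"
      if "x \<in> range to_ac" "y \<in> range to_ac" for x y :: "'a alg_closure"
      using that by (metis (no_types, lifting) imageE rangeI to_ac_diff, metis (no_types, lifting) imageE rangeI to_ac_mult)
    show "inverse x \<in> range to_ac" if "x \<in> range to_ac" for x :: "'a alg_closure"
      using that by (metis imageE rangeI to_ac_inverse)
  qed
  have cardF: "card (range (to_ac :: 'a \<Rightarrow> _)) = q"
    using card_image[OF inj_to_ac[where ?'a = 'a]] q(2) by simp
  have FK: "range to_ac \<subseteq> K"
  proof
    fix x :: "'a alg_closure" assume "x \<in> range to_ac"
    then have x: "x ^ q = x" using mem_finite_subfield_iff[OF F] cardF by simp
    have "x ^ (q ^ k) = x" for k by (induction k) (simp_all add: x power_mult)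
    then show "x \<in> K" by (simp add: K_def n_def)
  qed
  obtain \<alpha> where \<alpha>: "\<alpha> \<in> K" "\<alpha> \<noteq> 0" "\<And>x. x \<in> K \<Longrightarrow> x \<noteq> 0 \<Longrightarrow> \<exists>k::nat. x = \<alpha> ^ k"
    using finite_subfield_generator[OF K] by blast
  show ?thesis by (rule that[of K \<alpha>]) (unfold_locales, use F K FK cardF cardK \<alpha> in auto)
qed

section \<open>Coordinates over the base field\<close>

context quintic_extension begin

text \<open>Otherwise all powers of \<open>\<alpha>\<close>, hence all of \<open>K\<close>, lie in the span of at most four of
  them.\<close>

lemma gen_powers_independent:
  assumes f: "\<And>i. i < 5 \<Longrightarrow> f i \<in> F" and sum: "(\<Sum>i<5. f i * \<alpha> ^ i) = 0" and i: "i < 5"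
  shows "f i = 0"
proof (rule ccontr)
  assume "f i \<noteq> 0"
  \<comment> \<open>The leading index of the relation, which expresses \<open>\<alpha> ^ d\<close>
    by lower powers; \<open>S\<close> is the span of these.\<close>
  define d where "d = Max {i. i < 5 \<and> f i \<noteq> 0}"
  have fin: "finite {i. i < 5 \<and> f i \<noteq> 0}" by simp
  have "d \<in> {i. i < 5 \<and> f i \<noteq> 0}"
    unfolding d_def by (rule Max_in[OF fin]) (use \<open>f i \<noteq> 0\<close> i in auto)
  then have d: "d < 5" "f d \<noteq> 0" by auto
  have above: "f j = 0" if "d < j" "j < 5" for j
  proof (rule ccontr)
    assume "f j \<noteq> 0"
    then have "j \<le> d" unfolding d_def by (intro Max_ge[OF fin]) (use that in auto)
    then show False using that by simp
  qed
  define S where "S = (\<lambda>h. \<Sum>i<d. h i * \<alpha> ^ i) ` (\<Pi>\<^sub>E i\<in>{..<d}. F)"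
  have SI: "(\<Sum>i<d. h i * \<alpha> ^ i) \<in> S" if "\<And>i. i < d \<Longrightarrow> h i \<in> F" for h
    unfolding S_def by (rule image_eqI[of _ _ "restrict h {..<d}"]) (use that in auto)
  have SE: "\<exists>h. (\<forall>i<d. h i \<in> F) \<and> s = (\<Sum>i<d. h i * \<alpha> ^ i)" if "s \<in> S" for s
    using that by (auto simp: S_def PiE_def Pi_def)
  have "(\<Sum>i<5. f i * \<alpha> ^ i) = (\<Sum>i<Suc d. f i * \<alpha> ^ i)"
    by (rule sum.mono_neutral_right) (use d above in auto)
  then have "(\<Sum>i<d. f i * \<alpha> ^ i) + f d * \<alpha> ^ d = 0" using sum by simp
  then have "f d * \<alpha> ^ d = - (\<Sum>i<d. f i * \<alpha> ^ i)"
    by (simp add: eq_neg_iff_add_eq_0 add.commute)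
  then have "\<alpha> ^ d = - (\<Sum>i<d. f i * \<alpha> ^ i) / f d"
    using d(2) by (metis nonzero_mult_div_cancel_left)
  also have "\<dots> = (\<Sum>i<d. (- f i / f d) * \<alpha> ^ i)"
    by (simp add: sum_divide_distrib sum_negf[symmetric])
  finally have ad: "\<alpha> ^ d = (\<Sum>i<d. (- f i / f d) * \<alpha> ^ i)" .
  have d0: "d \<noteq> 0"
  proof
    assume "d = 0"
    then have "\<alpha> ^ d = 0" by (subst ad) simp
    then show False using gen_K(2) by simp
  qed
  have step: "\<alpha> * s \<in> S" if "s \<in> S" for s
  proof -
    from SE[OF that] obtain h where
      h: "\<And>i. i < d \<Longrightarrow> h i \<in> F" "s = (\<Sum>i<d. h i * \<alpha> ^ i)" by auto
    obtain d' where d': "d = Suc d'" using d0 by (cases d) auto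
    \<comment> \<open>Multiplication by \<alpha> shifts the coefficients, and the overflow
      \<open>h d' * \<alpha> ^ d\<close> is reduced by the relation.\<close>
    define h' where "h' = (\<lambda>i. (if i = 0 then 0 else h (i - 1)) + h d' * (- f i / f d))"
    have "\<alpha> * s = (\<Sum>i<d. h i * \<alpha> ^ Suc i)" by (simp add: h(2) sum_distrib_left mult_ac)
    also have "\<dots> = (\<Sum>i<d'. h i * \<alpha> ^ Suc i) + h d' * \<alpha> ^ d" by (simp add: d')
    also have "(\<Sum>i<d'. h i * \<alpha> ^ Suc i) = (\<Sum>i<d. (if i = 0 then 0 else h (i - 1)) * \<alpha> ^ i)"
      unfolding d' by (subst sum.lessThan_Suc_shift) simp
    also have "h d' * \<alpha> ^ d = (\<Sum>i<d. h d' * (- f i / f d) * \<alpha> ^ i)"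
      unfolding ad sum_distrib_left by (simp add: mult.assoc)
    finally have "\<alpha> * s = (\<Sum>i<d. h' i * \<alpha> ^ i)"
      by (simp only: h'_def sum.distrib distrib_right)
    moreover have "h' i \<in> F" if "i < d" for i
      using h(1)[of "i - 1"] h(1)[of d'] f[of i] f[of d] d d' that by (auto simp: h'_def)
    ultimately show ?thesis using SI by simp
  qed
  have pow: "\<alpha> ^ k \<in> S" for k
  proof (induction k)
    case 0
    have "(\<Sum>i<d. (if i = 0 then 1 else 0) * \<alpha> ^ i) \<in> S" by (rule SI) auto
    moreover have "(\<Sum>i<d. (if i = 0 then 1 else 0) * \<alpha> ^ i) = (\<Sum>i<d. if i = 0 then 1 else 0)"
      by (rule sum.cong) auto
    ultimately show ?case using d0 by simp
  next
    case (Suc k) then show ?case using step by simp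
  qed
  have "(\<Sum>i<d. 0 * \<alpha> ^ i) \<in> S" by (rule SI) auto
  then have "0 \<in> S" by simp
  then have "K \<subseteq> S" using pow gen by (metis subsetI)
  moreover have finP: "finite (\<Pi>\<^sub>E i\<in>{..<d}. F)" by (rule finite_PiE) auto
  ultimately have "card K \<le> card S" by (intro card_mono) (auto simp: S_def)
  also have "\<dots> \<le> card (\<Pi>\<^sub>E i\<in>{..<d}. F)" unfolding S_def by (rule card_image_le[OF finP])
  also have "\<dots> = q ^ d" by (simp add: card_PiE card_F)
  also have "\<dots> < q ^ 5" using power_less_q d by simp
  finally show False using card_K by simp
qed

end

text \<open>Coordinates in a basis are unique; this links dimension with the cardinalities used in
  the extension field.\<close>

lemma card_vec_subspace:
  fixes W :: "('a::{Fields.field, finite} ^ 'n) set"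
  assumes "vec.subspace W"
  shows "card W = CARD('a) ^ vec.dim W"
proof -
  obtain B where B: "B \<subseteq> W" "vec.independent B" "W \<subseteq> vec.span B" "card B = vec.dim W"
    using vec.basis_exists by blast
  have finB: "finite B" by simp
  have span: "vec.span B = W" using B assms by (simp add: vec.span_minimal subset_antisym)
  define s where "s = (\<lambda>u. \<Sum>v\<in>B. u v *s v)"
  have "W = s ` (\<Pi>\<^sub>E v\<in>B. UNIV)"
  proof (intro equalityI subsetI)
    fix x assume "x \<in> W"
    then obtain u where "x = s u" using vec.span_finite[OF finB] span by (auto simp: s_def)
    then have "x = s (restrict u B)" by (simp add: s_def)
    then show "x \<in> s ` (\<Pi>\<^sub>E v\<in>B. UNIV)" by auto
  next
    fix x assume "x \<in> s ` (\<Pi>\<^sub>E v\<in>B. UNIV)"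
    then show "x \<in> W" using vec.span_finite[OF finB] span by (auto simp: s_def)
  qed
  moreover have "inj_on s (\<Pi>\<^sub>E v\<in>B. UNIV)"
  proof (rule inj_onI)
    fix u w assume uw: "u \<in> (\<Pi>\<^sub>E v\<in>B. UNIV)" "w \<in> (\<Pi>\<^sub>E v\<in>B. UNIV)" "s u = s w"
    then have "(\<Sum>v\<in>B. (u v - w v) *s v) = 0"
      by (simp add: s_def vec.scale_left_diff_distrib sum_subtractf)
    from vec.independentD[OF B(2) finB subset_refl this] have "u v = w v" if "v \<in> B" for v
      using that by force
    then show "u = w" using uw by (intro PiE_ext) auto
  qed
  ultimately have "card W = card (\<Pi>\<^sub>E v\<in>B. (UNIV :: 'a set))" using card_image by metis
  then show ?thesis using finB B(4) by (simp add: card_PiE)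
qed

lemma hamiltonian_cycleI:
  fixes f :: "nat \<Rightarrow> 'v"
  assumes G: "tail G = fst" "head G = snd" and n: "3 \<le> n"
    and arcs: "\<And>t. t < n \<Longrightarrow> (f t, f (Suc t)) \<in> arcs G" and closed: "f n = f 0"
    and bij: "bij_betw f {..<n} (verts G)"
  shows "hamiltonian_cycle G (map (\<lambda>t. (f t, f (Suc t))) [0..<n])"
proof -
  define p where "p = (\<lambda>n. map (\<lambda>t. (f t, f (Suc t))) [0..<n])"
  have cas: "pre_digraph.cas G (f s) (map (\<lambda>t. (f t, f (Suc t))) [s..<s + k]) (f (s + k))" for s k
  proof (induction k arbitrary: s)
    case 0 then show ?case by (simp add: pre_digraph.cas.simps)
  next
    case (Suc k)
    have "[s..<s + Suc k] = s # [Suc s..<Suc s + k]" by (simp add: upt_conv_Cons)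
    then show ?case using Suc[of "Suc s"] by (simp add: pre_digraph.cas.simps G)
  qed
  have cas0: "pre_digraph.cas G (f 0) (p n) (f 0)" using cas[of 0 n] closed by (simp add: p_def)
  have ne: "p n \<noteq> []" using n by (simp add: p_def)
  have hd: "tail G (hd (p n)) = f 0" using n by (simp add: p_def hd_map G)
  have verts: "pre_digraph.awalk_verts G (f 0) (p n) = f 0 # map (\<lambda>t. f (Suc t)) [0..<n]"
    using pre_digraph.awalk_verts_conv'[OF cas0] ne hd by (simp add: p_def G o_def)
  \<comment> \<open>A cycle requires distinctness after the first vertex, that is, of
    \<open>f 1\<close> to \<open>f n\<close>, a rotation of \<open>f 0\<close> to
    \<open>f (n - 1)\<close>.\<close>
  have im: "(\<lambda>t. f (Suc t)) ` {..<n} = f ` {..<n}"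
  proof (intro equalityI subsetI)
    fix y assume "y \<in> (\<lambda>t. f (Suc t)) ` {..<n}"
    then obtain t where t: "t < n" "y = f (Suc t)" by auto
    then show "y \<in> f ` {..<n}"
      using closed n by (cases "Suc t = n") (auto intro: image_eqI[of _ _ 0])
  next
    fix y assume "y \<in> f ` {..<n}"
    then obtain t where t: "t < n" "y = f t" by auto
    then show "y \<in> (\<lambda>t. f (Suc t)) ` {..<n}"
      using closed n by (cases t) (auto intro: image_eqI[of _ _ "n - 1"])
  qed
  have fV: "f ` {..<n} = verts G" using bij by (simp add: bij_betw_def)
  have f0: "f 0 \<in> verts G" using n fV by auto
  have "distinct (map (\<lambda>t. f (Suc t)) [0..<n])"
  proof -
    have "card (set (map (\<lambda>t. f (Suc t)) [0..<n])) = card (f ` {..<n})"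
      using im by (simp add: lessThan_atLeast0)
    also have "\<dots> = card {..<n}" by (rule card_image) (use bij in \<open>simp add: bij_betw_def\<close>)
    finally show ?thesis by (intro card_distinct) simp
  qed
  moreover have "set (p n) \<subseteq> arcs G" using arcs by (auto simp: p_def)
  ultimately have "pre_digraph.cycle G (p n)"
    unfolding pre_digraph.cycle_def pre_digraph.awalk_def using cas0 f0 ne verts by (intro exI[of _ "f 0"]) simp
  moreover have "set (pre_digraph.awalk_verts G (tail G (hd (p n))) (p n)) = verts G"
    unfolding hd verts using im fV f0 by (auto simp: lessThan_atLeast0)
  ultimately show ?thesis unfolding hamiltonian_cycle_def using n by (simp add: p_def)
qed

text \<open>The coordinates belong to the basis of the first five powers of \<alpha>: independence
  gives injectivity, and counting then gives surjectivity.\<close>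

lemma quintic_extension_coordinates:
  assumes "quintic_extension (range (to_ac :: 'a::{Fields.field, finite} \<Rightarrow> _)) K \<alpha> q"
  obtains \<phi> :: "'a::{Fields.field, finite} ^ 5 \<Rightarrow> 'a alg_closure" where
    "\<And>u v. \<phi> (u + v) = \<phi> u + \<phi> v" "\<And>c v. \<phi> (c *s v) = to_ac c * \<phi> v" "bij_betw \<phi> UNIV K"
proof -
  interpret quintic_extension "range (to_ac :: 'a \<Rightarrow> _)" K \<alpha> q by fact
  obtain e :: "5 \<Rightarrow> nat" where e: "bij_betw e UNIV {..<5}"
    using ex_bij_betw_finite_nat[of "UNIV :: 5 set"] by (auto simp: lessThan_atLeast0)
  define \<phi> :: "'a ^ 5 \<Rightarrow> 'a alg_closure" where "\<phi> = (\<lambda>v. \<Sum>i\<in>UNIV. to_ac (v $ i) * \<alpha> ^ e i)"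
  have add: "\<phi> (u + v) = \<phi> u + \<phi> v" for u v
    by (simp add: \<phi>_def distrib_right sum.distrib)
  have scale: "\<phi> (c *s v) = to_ac c * \<phi> v" for c v
    by (simp add: \<phi>_def sum_distrib_left mult.assoc)
  have q: "CARD('a) = q" using card_F card_image[OF inj_to_ac[where ?'a = 'a]] by simp
  have "\<phi> v \<in> K" for v
  proof -
    have "(\<Sum>i\<in>A. to_ac (v $ i) * \<alpha> ^ e i) \<in> K" for A
      by (induction A rule: infinite_finite_induct) auto
    then show ?thesis by (simp add: \<phi>_def)
  qed
  then have sub: "range \<phi> \<subseteq> K" by auto
  have ker: "v = 0" if "\<phi> v = 0" for v
  proof -
    define f where "f = (\<lambda>j. to_ac (v $ inv_into UNIV e j))"
    have inj: "inj e" using e by (simp add: bij_betw_def)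
    have "(\<Sum>j<5. f j * \<alpha> ^ j) = (\<Sum>i\<in>UNIV. f (e i) * \<alpha> ^ e i)"
      by (rule sum.reindex_bij_betw[OF e, symmetric])
    also have "\<dots> = 0" using that inj by (simp add: \<phi>_def f_def)
    finally have z: "(\<Sum>j<5. f j * \<alpha> ^ j) = 0" .
    have "v $ i = 0" for i
    proof -
      have "f (e i) = 0"
        by (rule gen_powers_independent[OF _ z]) (use bij_betwE[OF e] in \<open>auto simp: f_def\<close>)
      then show ?thesis using inj by (simp add: f_def)
    qed
    then show ?thesis by (simp add: vec_eq_iff)
  qed
  have inj: "inj \<phi>"
  proof (rule injI)
    fix u v assume "\<phi> u = \<phi> v"
    then have "\<phi> (u - v) = 0" using add[of "u - v" v] by simp
    then show "u = v" using ker[of "u - v"] by simp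
  qed
  have "card (range \<phi>) = card K" using card_image[OF inj] card_K q by simp
  then have "range \<phi> = K" using sub by (intro card_subset_eq) auto
  then show ?thesis using that[of \<phi>] add scale inj by (simp add: bij_betw_def)
qed

text \<open>\<phi> is additive and respects scalars along \<open>to_ac\<close>, so preimages and
  images of subspaces are inverse to each other; \<open>card_vec_subspace\<close> matches
  \<open>q ^ k\<close> elements with dimension \<open>k\<close>.\<close>

lemma bij_betw_vimage_subspaces:
  fixes \<phi> :: "'a::{Fields.field, finite} ^ 5 \<Rightarrow> 'a alg_closure"
  assumes ext: "quintic_extension (range (to_ac :: 'a \<Rightarrow> _)) K \<alpha> q"
    and add: "\<And>u v. \<phi> (u + v) = \<phi> u + \<phi> v" and scale: "\<And>c v. \<phi> (c *s v) = to_ac c * \<phi> v"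
    and bij: "bij_betw \<phi> UNIV K"
  shows "bij_betw (vimage \<phi>) {W. quintic_extension.subsp (range (to_ac :: 'a \<Rightarrow> _)) K W \<and> card W = q ^ k}
    {W. vec.subspace W \<and> vec.dim W = k}"
proof -
  interpret quintic_extension "range (to_ac :: 'a \<Rightarrow> _)" K \<alpha> q by fact
  have q: "CARD('a) = q" using card_F card_image[OF inj_to_ac[where ?'a = 'a]] by simp
  have inj: "inj \<phi>" and ran: "range \<phi> = K" using bij by (auto simp: bij_betw_def)
  have zero: "\<phi> 0 = 0" using scale[of 0 0] by simp
  have dim: "card W = q ^ k \<longleftrightarrow> vec.dim W = k" if "vec.subspace W" for W :: "('a ^ 5) set"
    using card_vec_subspace[OF that] q q_ge_2 by simp
  show ?thesis
  proof (rule bij_betwI[where g = "image \<phi>"])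
    show "vimage \<phi> \<in> {W. subsp W \<and> card W = q ^ k} \<rightarrow> {W. vec.subspace W \<and> vec.dim W = k}"
    proof clarify
      fix W assume W: "subsp W" "card W = q ^ k"
      note W' = subspD[OF W(1)]
      have "vec.subspace (\<phi> -` W)" unfolding vec.subspace_def
        using W' by (auto simp: zero add scale)
      moreover have "card (\<phi> -` W) = q ^ k"
        using card_vimage_inj[OF inj, of W] W(2) W'(1) ran by simp
      ultimately show "vec.subspace (\<phi> -` W) \<and> vec.dim (\<phi> -` W) = k" using dim by blast
    qed
    show "image \<phi> \<in> {W. vec.subspace W \<and> vec.dim W = k} \<rightarrow> {W. subsp W \<and> card W = q ^ k}"
    proof clarify
      fix W :: "('a ^ 5) set" assume W: "vec.subspace W" "k = vec.dim W"
      have "subsp (\<phi> ` W)" unfolding subsp_def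
      proof (intro conjI ballI)
        show "\<phi> ` W \<subseteq> K" using ran by auto
        show "0 \<in> \<phi> ` W" using zero vec.subspace_0[OF W(1)] by (metis imageI)
        show "x + y \<in> \<phi> ` W" if "x \<in> \<phi> ` W" "y \<in> \<phi> ` W" for x y
          using that vec.subspace_add[OF W(1)] by (auto simp: add[symmetric])
        show "f * x \<in> \<phi> ` W" if "f \<in> range to_ac" "x \<in> \<phi> ` W" for f x
          using that vec.subspace_scale[OF W(1)] by (auto simp: scale[symmetric])
      qed
      moreover have "card (\<phi> ` W) = q ^ vec.dim W"
        using dim[OF W(1)] W(2) inj by (simp add: card_image inj_on_subset)
      ultimately show "subsp (\<phi> ` W) \<and> card (\<phi> ` W) = q ^ vec.dim W" by blast
    qed
    show "\<phi> ` \<phi> -` W = W" if "W \<in> {W. subsp W \<and> card W = q ^ k}" for W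
      using that subspD(1) ran by (auto simp: image_vimage_eq)
    show "\<phi> -` \<phi> ` W = W" for W using inj by (rule inj_vimage_image_eq)
  qed
qed

theorem theorem2:
  fixes q :: nat
  assumes "primepow q"
    and "CARD('a::{field, finite}) = q"
  shows "\<exists>p. hamiltonian_cycle
           (middle_levels_graph 2 ::
             (('a ^ 5) set, ('a ^ 5) set \<times> ('a ^ 5) set) pre_digraph) p"
proof -
  let ?G = "middle_levels_graph 2 :: (('a ^ 5) set, ('a ^ 5) set \<times> ('a ^ 5) set) pre_digraph"
  obtain K :: "'a alg_closure set" and \<alpha> where ext: "quintic_extension (range to_ac) K \<alpha> q"
    using quintic_extension_exists[OF assms] .
  then interpret quintic_extension "range (to_ac :: 'a \<Rightarrow> _)" K \<alpha> q .
  obtain \<phi> :: "'a ^ 5 \<Rightarrow> 'a alg_closure" where \<phi>: "\<And>u v. \<phi> (u + v) = \<phi> u + \<phi> v"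
    "\<And>c v. \<phi> (c *s v) = to_ac c * \<phi> v" "bij_betw \<phi> UNIV K"
    using quintic_extension_coordinates[OF ext] by blast
  note transfer = bij_betw_vimage_subspaces[OF ext \<phi>]
  obtain n L P where n: "2 \<le> n" and closed: "L n = L 0"
    and LP: "\<And>t. L t \<subseteq> P t" "\<And>t. L (Suc t) \<subseteq> P t"
    and bijs: "bij_betw L {..<n} {W. subsp W \<and> card W = q ^ 2}"
      "bij_betw P {..<n} {W. subsp W \<and> card W = q ^ 3}"
    by (rule line_plane_cycle) blast
  define L' where "L' = (\<lambda>t. \<phi> -` L t)"
  define P' where "P' = (\<lambda>t. \<phi> -` P t)"
  have bijL: "bij_betw L' {..<n} {W. vec.subspace W \<and> vec.dim W = 2}"
    using bij_betw_trans[OF bijs(1) transfer[of 2]] by (simp add: L'_def o_def)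
  have bijP: "bij_betw P' {..<n} {W. vec.subspace W \<and> vec.dim W = 3}"
    using bij_betw_trans[OF bijs(2) transfer[of 3]] by (simp add: P'_def o_def)
  have closed': "L' n = L' 0" using closed by (simp add: L'_def)
  \<comment> \<open>The bound includes \<open>n\<close>, since the last plane is followed by
    \<open>L' n = L' 0\<close>.\<close>
  have subL: "vec.subspace (L' t) \<and> vec.dim (L' t) = 2" if "t \<le> n" for t
  proof -
    have "L' t \<in> L' ` {..<n}" using that closed' n by (cases "t = n") auto
    then show ?thesis using bijL by (auto simp: bij_betw_def)
  qed
  have subP: "vec.subspace (P' t) \<and> vec.dim (P' t) = 3" if "t < n" for t
    using bij_betwE[OF bijP] that by auto
  \<comment> \<open>As \<open>A\<close> lies in \<open>B\<close>, the intersection is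
    \<open>A\<close>, and 2 + 3 - 2 * 2 = 1.\<close>
  have arc: "(A, B) \<in> arcs ?G \<and> (B, A) \<in> arcs ?G"
    if "vec.subspace A \<and> vec.dim A = 2" "vec.subspace B \<and> vec.dim B = 3" "A \<subseteq> B" for A B
    using that by (simp add: middle_levels_graph_def subspace_graph_def induce_subgraph_def
        Int_absorb1 Int_absorb2)
  \<comment> \<open>Lines at even times and planes at odd times enumerate the two levels
    separately.\<close>
  define f where "f = (\<lambda>t. if even t then L' (t div 2) else P' (t div 2))"
  have "hamiltonian_cycle ?G (map (\<lambda>t. (f t, f (Suc t))) [0..<2 * n])"
  proof (rule hamiltonian_cycleI)
    show "tail ?G = fst" "head ?G = snd"
      by (simp_all add: middle_levels_graph_def subspace_graph_def induce_subgraph_def)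
    show "3 \<le> 2 * n" using n by simp
    show "f (2 * n) = f 0" using closed' by (simp add: f_def)
    show "(f t, f (Suc t)) \<in> arcs ?G" if "t < 2 * n" for t
    proof (cases "even t")
      case True
      then obtain s where s: "t = 2 * s" by blast
      then have "s < n" using that by simp
      then have "(L' s, P' s) \<in> arcs ?G" using arc[OF subL[of s] subP[of s]] LP(1)[of s]
        by (auto simp: L'_def P'_def)
      then show ?thesis by (simp add: f_def s)
    next
      case False
      then obtain s where s: "t = 2 * s + 1" by (elim oddE)
      then have "s < n" using that by simp
      then have "(P' s, L' (Suc s)) \<in> arcs ?G"
        using arc[OF subL[of "Suc s"] subP[of s]] LP(2)[of s] by (auto simp: L'_def P'_def)
      then show ?thesis by (simp add: f_def s)
    qed
    have V: "verts ?G = {W. vec.subspace W \<and> vec.dim W = 2} \<union> {W. vec.subspace W \<and> vec.dim W = 3}"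
      by (auto simp: middle_levels_graph_def induce_subgraph_def)
    define E where "E = {t. t < 2 * n \<and> even t}"
    define D where "D = {t. t < 2 * n \<and> odd t}"
    have hE: "bij_betw (\<lambda>t. t div 2) E {..<n}"
      by (rule bij_betwI[where g = "\<lambda>t. 2 * t"]) (auto simp: E_def)
    have hD: "bij_betw (\<lambda>t. t div 2) D {..<n}"
      by (rule bij_betwI[where g = "\<lambda>t. 2 * t + 1"]) (auto simp: D_def)
    have "bij_betw f E {W. vec.subspace W \<and> vec.dim W = 2}"
      using bij_betw_trans[OF hE bijL] by (subst bij_betw_cong[of _ _ "L' \<circ> (\<lambda>t. t div 2)"]) (auto simp: E_def f_def)
    moreover have "bij_betw f D {W. vec.subspace W \<and> vec.dim W = 3}"
      using bij_betw_trans[OF hD bijP] by (subst bij_betw_cong[of _ _ "P' \<circ> (\<lambda>t. t div 2)"]) (auto simp: D_def f_def)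
    ultimately have "bij_betw f (E \<union> D) (verts ?G)" unfolding V by (rule bij_betw_combine) auto
    moreover have "E \<union> D = {..<2 * n}" by (auto simp: E_def D_def)
    ultimately show "bij_betw f {..<2 * n} (verts ?G)" by simp
  qed
  then show ?thesis by blast
qed

end
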